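(* Let $d\ge3$ and $\ell\in\mathbb{N}$, and let $\{Y_\ell^m\}_{m=1}^{N(d,\ell)}$ be an orthonormal basis (in $L^2(S^d,d\sigma_d)$) of the space of complex spherical harmonics of degree $\ell$ on $S^d$. Then for every $j=1,\dots,d$ and every $\hat\theta\in S^d$ (away from coordinate singularities), $$\sum_{m=1}^{N(d,\ell)}\frac{1}{\eta_j^2}\,\bigl|\partial_{\theta_j}Y_\ell^m(\hat\theta)\bigr|^2=(d-1)\,K(d,\ell)\,C_{\ell-1}^{(\frac{d+1}{2})}(1),\qquad K(d,\ell)=\frac{N(d,\ell)}{|S^d|\,C_\ell^{(\frac{d-1}{2})}(1)},$$ with the convention $C_{-1}^{(\alpha)}\equiv0$.
   Context: Hyperspherical coordinates on $\mathbb{R}^{d+1}$: $x_{d+1}=r\cos\theta_d$, $x_d=r\sin\theta_d\cos\theta_{d-1}$, …, $x_3=r\sin\theta_d\cdots\sin\theta_3\cos\theta_2$, $x_2=r\sin\theta_d\cdots\sin\theta_2\sin\theta_1$, $x_1=r\sin\theta_d\cdots\sin\theta_2\cos\theta_1$, with $\theta_1\in[0,2\pi)$, $\theta_2,\dots,\theta_d\in[0,\pi]$. Define $\eta_j=\prod_{i=j+1}^d\sin\theta_i$ (so $\eta_d=1$); the surface measure is $d\sigma_d=\prod_{j=2}^d\sin^{j-1}\theta_j\,d\theta_1\cdots d\theta_d$, and $|S^d|$ is the surface area of $S^d$. $N(d,0)=1$, $N(d,\ell)=\binom{d+\ell}{d}-\binom{d+\ell-2}{d}$ for $\ell\ge1$.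 $C_n^{(\alpha)}$ denotes the Gegenbauer polynomial of degree $n$ with the standard normalisation ($C_n^{(\alpha)}(1)=(2\alpha)_n/n!$). *)

theory Defs
  imports "HOL-Analysis.Analysis"
begin

text \<open>Points of R^(d+1) are functions nat => real, coordinates 1..d+1.
 Angles theta are functions nat => real, coordinates 1..d.\<close>

definition sph :: "nat \<Rightarrow> (nat \<Rightarrow> real) \<Rightarrow> (nat \<Rightarrow> real)" where
  "sph d \<theta> = (\<lambda>k.
     if k = 1 then (\<Prod>i=2..d. sin (\<theta> i)) * cos (\<theta> 1)
     else if k = 2 then (\<Prod>i=2..d. sin (\<theta> i)) * sin (\<theta> 1)
     else if 3 \<le> k \<and> k \<le> d + 1 then (\<Prod>i=k..d. sin (\<theta> i)) * cos (\<theta> (k - 1))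
     else 0)"

definition eta :: "nat \<Rightarrow> nat \<Rightarrow> (nat \<Rightarrow> real) \<Rightarrow> real" where
  "eta d j \<theta> = (\<Prod>i=j+1..d. sin (\<theta> i))"

text \<open>Density of the surface measure d sigma_d in hyperspherical coordinates.\<close>
definition sph_weight :: "nat \<Rightarrow> (nat \<Rightarrow> real) \<Rightarrow> real" where
  "sph_weight d \<theta> = (\<Prod>j=2..d. sin (\<theta> j) ^ (j - 1))"

definition angle_dom :: "nat \<Rightarrow> (nat \<Rightarrow> real) set" where
  "angle_dom d = {\<theta>. \<theta> 1 \<in> {0..<2*pi} \<and> (\<forall>j\<in>{2..d}. \<theta> j \<in> {0..pi})}"

definition angle_measure :: "nat \<Rightarrow> (nat \<Rightarrow> real) measure" where
  "angle_measure d = PiM {1..d} (\<lambda>_. lborel)"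

definition sph_inner :: "nat \<Rightarrow> ((nat \<Rightarrow> real) \<Rightarrow> complex) \<Rightarrow> ((nat \<Rightarrow> real) \<Rightarrow> complex) \<Rightarrow> complex" where
  "sph_inner d f g = (LINT \<theta>:angle_dom d|angle_measure d.
       f (sph d \<theta>) * cnj (g (sph d \<theta>)) * of_real (sph_weight d \<theta>))"

definition sphere_area :: "nat \<Rightarrow> real" where
  "sphere_area d = (LINT \<theta>:angle_dom d|angle_measure d. sph_weight d \<theta>)"

definition hom_poly :: "nat \<Rightarrow> nat \<Rightarrow> ((nat \<Rightarrow> real) \<Rightarrow> complex) \<Rightarrow> bool" where
  "hom_poly d l P \<longleftrightarrow> (\<exists>A c. finite A \<and>
      (\<forall>\<alpha>\<in>A. (\<forall>i. i \<notin> {1..d+1} \<longrightarrow> \<alpha> i = 0) \<and> (\<Sum>i=1..d+1. \<alpha> i) = l) \<and>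
      (\<forall>x. P x = (\<Sum>\<alpha>\<in>A. c \<alpha> * (\<Prod>i=1..d+1. complex_of_real (x i) ^ \<alpha> i))))"

definition partial :: "nat \<Rightarrow> ((nat \<Rightarrow> real) \<Rightarrow> complex) \<Rightarrow> (nat \<Rightarrow> real) \<Rightarrow> complex" where
  "partial i P x = vector_derivative (\<lambda>s. P (x(i := s))) (at (x i))"

definition laplacian :: "nat \<Rightarrow> ((nat \<Rightarrow> real) \<Rightarrow> complex) \<Rightarrow> (nat \<Rightarrow> real) \<Rightarrow> complex" where
  "laplacian d P x = (\<Sum>i=1..d+1. partial i (partial i P) x)"

text \<open>Spherical harmonics of degree l on S^d: (restrictions of) harmonic
 homogeneous polynomials of degree l on R^(d+1).\<close>
definition sph_harm :: "nat \<Rightarrow> nat \<Rightarrow> ((nat \<Rightarrow> real) \<Rightarrow> complex) set" where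
  "sph_harm d l = {P. hom_poly d l P \<and> (\<forall>x. laplacian d P x = 0)}"

definition Ndim :: "nat \<Rightarrow> nat \<Rightarrow> nat" where
  "Ndim d l = (if l = 0 then 1 else ((d + l) choose d) - ((d + l - 2) choose d))"

fun gegenbauer :: "nat \<Rightarrow> real \<Rightarrow> real \<Rightarrow> real" where
  "gegenbauer 0 a x = 1"
| "gegenbauer (Suc 0) a x = 2 * a * x"
| "gegenbauer (Suc (Suc n)) a x =
     (2 * x * (real n + 1 + a) * gegenbauer (Suc n) a x - (real n + 2 * a) * gegenbauer n a x) / (real n + 2)"

definition Kconst :: "nat \<Rightarrow> nat \<Rightarrow> real" where
  "Kconst d l = real (Ndim d l) / (sphere_area d * gegenbauer l ((real d - 1) / 2) 1)"

end

theory Submission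
  imports Defs
begin

text \<open>
  For vectors \<open>v, w\<close> let \<open>L\<close> be the infinitesimal rotation
  \<open>L F(y) = (v \<cdot> y) \<partial>\<^sub>w F(y) - (w \<cdot> y) \<partial>\<^sub>v F(y)\<close>. It preserves the harmonic homogeneous
  polynomials and is skew for the \<open>L\<^sup>2\<close> product; the latter follows from the recursion
  \<open>(|\<beta>| + d + 1) I(\<beta> + 2e\<^sub>a) = (\<beta>\<^sub>a + 1) I(\<beta>)\<close> for the integrals \<open>I(\<beta>)\<close> of monomials over the
  sphere. Hence \<open>L\<close> has a skew-Hermitian matrix in the basis \<open>Y\<^sub>m\<close>, so that
  \<open>\<Sum>\<^sub>m \<phi>(L Y\<^sub>m) cnj(\<psi>(Y\<^sub>m)) + \<phi>(Y\<^sub>m) cnj(\<psi>(L Y\<^sub>m)) = 0\<close> for all linear functionals \<open>\<phi>, \<psi>\<close>.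
  At a point \<open>x\<close> of the sphere three choices of functionals suffice.
  Evaluation at \<open>x\<close> shows that \<open>A = \<Sum>\<^sub>m |Y\<^sub>m|\<^sup>2\<close> is constant, hence \<open>A = N / |S\<^sup>d|\<close>.
  For \<open>v, w\<close> orthogonal to \<open>x\<close>, \<open>\<phi> = \<partial>\<^sub>v\<close> and \<open>\<psi> = \<partial>\<^sub>w\<close> show that \<open>\<Sum>\<^sub>m |\<partial>\<^sub>v Y\<^sub>m(x)|\<^sup>2 / |v|\<^sup>2\<close> does
  not depend on the tangent vector \<open>v\<close>. Finally \<open>\<phi>(F) = L F(x)\<close> and evaluation, summed over the
  rotations of the planes spanned by \<open>x\<close> and a coordinate vector, evaluate the total tangential
  energy as \<open>l (l + d - 1) A\<close>.
\<close>

section \<open>Homogeneous polynomials\<close>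

definition mon :: "nat \<Rightarrow> (nat \<Rightarrow> nat) \<Rightarrow> (nat \<Rightarrow> real) \<Rightarrow> real" where
  "mon d \<alpha> x = (\<Prod>i=1..d+1. x i ^ \<alpha> i)"

definition midx :: "nat \<Rightarrow> nat \<Rightarrow> (nat \<Rightarrow> nat) \<Rightarrow> bool" where
  "midx d l \<alpha> \<longleftrightarrow> (\<forall>i. i \<notin> {1..d+1} \<longrightarrow> \<alpha> i = 0) \<and> (\<Sum>i=1..d+1. \<alpha> i) = l"

lemma hom_poly_iff_mon:
  "hom_poly d l P \<longleftrightarrow> (\<exists>A c. finite A \<and> (\<forall>\<alpha>\<in>A. midx d l \<alpha>) \<and>
      (\<forall>x. P x = (\<Sum>\<alpha>\<in>A. c \<alpha> * of_real (mon d \<alpha> x))))"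
  by (simp add: hom_poly_def midx_def mon_def)

lemma hom_poly_zero [simp]: "hom_poly d l (\<lambda>x. 0)"
  unfolding hom_poly_iff_mon by (rule exI[of _ "{}"]) simp

lemma hom_poly_add_mon:
  assumes "hom_poly d l F" "midx d l \<alpha>"
  shows "hom_poly d l (\<lambda>x. F x + c * of_real (mon d \<alpha> x))"
proof -
  from assms(1) obtain A b where A: "finite A" "\<forall>\<alpha>\<in>A. midx d l \<alpha>"
    "\<And>x. F x = (\<Sum>\<alpha>\<in>A. b \<alpha> * of_real (mon d \<alpha> x))"
    unfolding hom_poly_iff_mon by blast
  \<comment> \<open>The monomial \<open>\<alpha>\<close> may already occur in \<open>A\<close>; in
    that case its old and new coefficients are added.\<close>
  define b' where "b' \<beta> = (if \<beta> \<in> A then b \<beta> else 0) + (if \<beta> = \<alpha> then c else 0)" for \<beta>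
  have "F x + c * of_real (mon d \<alpha> x) = (\<Sum>\<beta>\<in>insert \<alpha> A. b' \<beta> * of_real (mon d \<beta> x))" for x
  proof -
    have "(\<Sum>\<beta>\<in>insert \<alpha> A. b' \<beta> * of_real (mon d \<beta> x)) =
      (\<Sum>\<beta>\<in>insert \<alpha> A. if \<beta> \<in> A then b \<beta> * of_real (mon d \<beta> x) else 0) +
      (\<Sum>\<beta>\<in>insert \<alpha> A. if \<beta> = \<alpha> then c * of_real (mon d \<beta> x) else 0)"
      by (subst sum.distrib[symmetric]) (auto intro!: sum.cong simp: b'_def distrib_right)
    also have "(\<Sum>\<beta>\<in>insert \<alpha> A. if \<beta> \<in> A then b \<beta> * of_real (mon d \<beta> x) else 0) = F x"
      unfolding A(3) using A(1) by (intro sum.mono_neutral_cong_right) auto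
    also have "(\<Sum>\<beta>\<in>insert \<alpha> A. if \<beta> = \<alpha> then c * of_real (mon d \<beta> x) else 0) = c * of_real (mon d \<alpha> x)"
      using A(1) by (subst sum.delta) auto
    finally show ?thesis by simp
  qed
  then show ?thesis
    unfolding hom_poly_iff_mon using A(1,2) assms(2)
    by (intro exI[of _ "insert \<alpha> A"] exI[of _ b']) auto
qed

text \<open>Reduces statements that are linear in the polynomial to a single monomial. The later
  proofs go through this rule instead of opening the representation by \<open>A\<close> and
  \<open>c\<close>.\<close>

lemma hom_poly_induct [consumes 1, case_names zero add_mon]:
  assumes "hom_poly d l F"
    and zero: "Q (\<lambda>x. 0)"
    and step: "\<And>F c \<alpha>. hom_poly d l F \<Longrightarrow> Q F \<Longrightarrow> midx d l \<alpha> \<Longrightarrow>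
      Q (\<lambda>x. F x + c * of_real (mon d \<alpha> x))"
  shows "Q F"
proof -
  from assms(1) obtain A b where A: "finite A" "\<forall>\<alpha>\<in>A. midx d l \<alpha>"
    and F: "F = (\<lambda>x. \<Sum>\<alpha>\<in>A. b \<alpha> * of_real (mon d \<alpha> x))"
    unfolding hom_poly_iff_mon by (auto simp: fun_eq_iff)
  have "hom_poly d l (\<lambda>x. \<Sum>\<alpha>\<in>A. b \<alpha> * of_real (mon d \<alpha> x)) \<and>
    Q (\<lambda>x. \<Sum>\<alpha>\<in>A. b \<alpha> * of_real (mon d \<alpha> x))"
    using A
  proof (induction A rule: finite_induct)
    case empty
    then show ?case using zero by simp
  next
    case (insert \<alpha> A)
    then have IH: "hom_poly d l (\<lambda>x. \<Sum>\<alpha>\<in>A. b \<alpha> * of_real (mon d \<alpha> x))"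
      "Q (\<lambda>x. \<Sum>\<alpha>\<in>A. b \<alpha> * of_real (mon d \<alpha> x))" "midx d l \<alpha>" by auto
    show ?case using hom_poly_add_mon[OF IH(1,3), of "b \<alpha>"] step[OF IH, of "b \<alpha>"] insert(1,2)
      by (simp add: add.commute)
  qed
  then show ?thesis by (simp add: F)
qed

lemma hom_poly_mon: "midx d l \<alpha> \<Longrightarrow> hom_poly d l (\<lambda>x. c * of_real (mon d \<alpha> x))"
  using hom_poly_add_mon[OF hom_poly_zero] by simp

lemma hom_poly_add:
  assumes "hom_poly d l G" "hom_poly d l F"
  shows "hom_poly d l (\<lambda>x. F x + G x)"
  using assms(1)
proof (induction rule: hom_poly_induct)
  case zero
  then show ?case using assms(2) by simp
next
  case (add_mon G c \<alpha>)
  then show ?case using hom_poly_add_mon[OF add_mon(3,2), of c] by (simp add: add.assoc)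
qed

lemma hom_poly_cmult:
  assumes "hom_poly d l F"
  shows "hom_poly d l (\<lambda>x. c * F x)"
  using assms
proof (induction rule: hom_poly_induct)
  case (add_mon F b \<alpha>)
  then show ?case using hom_poly_add_mon[OF add_mon(3,2), of "c * b"]
    by (simp add: distrib_left mult.assoc)
qed simp

lemma hom_poly_diff:
  assumes "hom_poly d l F" "hom_poly d l G"
  shows "hom_poly d l (\<lambda>x. F x - G x)"
  using hom_poly_add[OF hom_poly_cmult[OF assms(2), of "-1"] assms(1)] by simp

lemma hom_poly_sum:
  assumes "\<And>m. m \<in> M \<Longrightarrow> hom_poly d l (F m)"
  shows "hom_poly d l (\<lambda>x. \<Sum>m\<in>M. F m x)"
  using assms by (induction M rule: infinite_finite_induct) (auto intro: hom_poly_add)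

lemma hom_poly_cnj:
  assumes "hom_poly d l F"
  shows "hom_poly d l (\<lambda>x. cnj (F x))"
  using assms
proof (induction rule: hom_poly_induct)
  case (add_mon F b \<alpha>)
  then show ?case using hom_poly_add_mon[OF add_mon(3,2), of "cnj b"] by simp
qed simp

lemma mon_mult: "mon d \<alpha> x * mon d \<beta> x = mon d (\<lambda>i. \<alpha> i + \<beta> i) x"
  by (simp add: mon_def power_add prod.distrib)

lemma midx_add: "midx d l \<alpha> \<Longrightarrow> midx d k \<beta> \<Longrightarrow> midx d (l + k) (\<lambda>i. \<alpha> i + \<beta> i)"
  by (auto simp: midx_def sum.distrib)

lemma hom_poly_mult:
  assumes "hom_poly d l F" "hom_poly d k G"
  shows "hom_poly d (l + k) (\<lambda>x. F x * G x)"
  using assms(1)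
proof (induction rule: hom_poly_induct)
  case (add_mon F c \<alpha>)
  from assms(2) have "hom_poly d (l + k) (\<lambda>x. of_real (mon d \<alpha> x) * G x)"
  proof (induction rule: hom_poly_induct)
    case (add_mon G b \<beta>)
    from hom_poly_add_mon[OF this(3) midx_add[OF \<open>midx d l \<alpha>\<close> this(2)], of b] show ?case
      by (simp flip: mon_mult add: algebra_simps)
  qed simp
  from hom_poly_add[OF hom_poly_cmult[OF this, of c] add_mon(3)] show ?case
    by (simp add: algebra_simps)
qed simp

section \<open>Derivatives of monomials and polynomials along curves\<close>

definition mon_partial :: "nat \<Rightarrow> nat \<Rightarrow> (nat \<Rightarrow> nat) \<Rightarrow> (nat \<Rightarrow> real) \<Rightarrow> real" where
  "mon_partial d i \<alpha> x = (if i \<in> {1..d+1} then real (\<alpha> i) * mon d (\<alpha>(i := \<alpha> i - 1)) x else 0)"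

text \<open>This is the product rule. The truncated exponent \<open>\<alpha> i - 1\<close> in
  \<open>mon_partial\<close> does no harm when \<open>\<alpha> i = 0\<close>, because the factor
  \<open>\<alpha> i\<close> kills the term.\<close>

lemma mon_curve_derivative:
  assumes "\<And>i. i \<in> {1..d+1} \<Longrightarrow> ((\<lambda>t. \<gamma> t i) has_real_derivative g i) (at t)"
  shows "((\<lambda>t. mon d \<alpha> (\<gamma> t)) has_real_derivative
    (\<Sum>i=1..d+1. g i * mon_partial d i \<alpha> (\<gamma> t))) (at t)"
proof -
  have "((\<lambda>t. \<Prod>i=1..d+1. \<gamma> t i ^ \<alpha> i) has_real_derivative
     (\<Sum>i=1..d+1. (real (\<alpha> i) * (g i * \<gamma> t i ^ (\<alpha> i - Suc 0))) * (\<Prod>j\<in>{1..d+1}-{i}. \<gamma> t j ^ \<alpha> j))) (at t)"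
    by (rule has_field_derivative_prod) (intro DERIV_power assms)
  also have "(\<Sum>i=1..d+1. (real (\<alpha> i) * (g i * \<gamma> t i ^ (\<alpha> i - Suc 0))) * (\<Prod>j\<in>{1..d+1}-{i}. \<gamma> t j ^ \<alpha> j))
    = (\<Sum>i=1..d+1. g i * mon_partial d i \<alpha> (\<gamma> t))"
  proof (rule sum.cong[OF refl])
    fix i assume i: "i \<in> {1..d+1}"
    have "mon d (\<alpha>(i := \<alpha> i - 1)) (\<gamma> t) = \<gamma> t i ^ (\<alpha> i - 1) * (\<Prod>j\<in>{1..d+1}-{i}. \<gamma> t j ^ \<alpha> j)"
      unfolding mon_def using i by (subst prod.remove[of _ i]) (auto intro!: prod.cong)
    then show "(real (\<alpha> i) * (g i * \<gamma> t i ^ (\<alpha> i - Suc 0))) * (\<Prod>j\<in>{1..d+1}-{i}. \<gamma> t j ^ \<alpha> j) =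
      g i * mon_partial d i \<alpha> (\<gamma> t)"
      using i by (simp add: mon_partial_def)
  qed
  finally show ?thesis by (simp add: mon_def)
qed

text \<open>Chain rule with a yet unnamed gradient \<open>D\<close>, chosen uniformly in the curve
  and the time. This form is additive in \<open>F\<close> and so suits the induction over
  monomials.\<close>

lemma hom_poly_curve_derivative_aux:
  assumes "hom_poly d l F"
  shows "\<exists>D. \<forall>\<gamma> g t. (\<forall>i\<in>{1..d+1}. ((\<lambda>t. \<gamma> t i) has_real_derivative g i) (at t)) \<longrightarrow>
    ((\<lambda>t. F (\<gamma> t)) has_vector_derivative (\<Sum>i=1..d+1. of_real (g i) * D i (\<gamma> t))) (at t)"
  using assms
proof (induction rule: hom_poly_induct)
  case zero
  show ?case by (rule exI[of _ "\<lambda>_ _. 0"]) simp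
next
  case (add_mon F c \<alpha>)
  then obtain D where D: "\<And>\<gamma> g t. (\<forall>i\<in>{1..d+1}. ((\<lambda>t. \<gamma> t i) has_real_derivative g i) (at t)) \<Longrightarrow>
    ((\<lambda>t. F (\<gamma> t)) has_vector_derivative (\<Sum>i=1..d+1. of_real (g i) * D i (\<gamma> t))) (at t)" by metis
  have "((\<lambda>t. F (\<gamma> t) + c * of_real (mon d \<alpha> (\<gamma> t))) has_vector_derivative
    (\<Sum>i=1..d+1. of_real (g i) * (D i (\<gamma> t) + c * of_real (mon_partial d i \<alpha> (\<gamma> t))))) (at t)"
    if *: "\<forall>i\<in>{1..d+1}. ((\<lambda>t. \<gamma> t i) has_real_derivative g i) (at t)" for \<gamma> :: "real \<Rightarrow> nat \<Rightarrow> real" and g t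
  proof -
    have "((\<lambda>t. F (\<gamma> t) + c * of_real (mon d \<alpha> (\<gamma> t))) has_vector_derivative
       (\<Sum>i=1..d+1. of_real (g i) * D i (\<gamma> t)) +
       c * of_real (\<Sum>i=1..d+1. g i * mon_partial d i \<alpha> (\<gamma> t))) (at t)"
      using * by (intro has_vector_derivative_add has_vector_derivative_mult_right
        has_vector_derivative_of_real mon_curve_derivative D) auto
    then show ?thesis by (simp add: sum_distrib_left sum.distrib algebra_simps del: sum.cl_ivl_Suc)
  qed
  then show ?case
    by (intro exI[of _ "\<lambda>i x. D i x + c * of_real (mon_partial d i \<alpha> x)"]) blast
qed

section \<open>Partial derivatives and infinitesimal rotations\<close>

lemma partial_eqI:
  "((\<lambda>s. F (x(i := s))) has_vector_derivative D) (at (x i)) \<Longrightarrow> partial i F x = D"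
  unfolding partial_def by (rule vector_derivative_at)

lemma fun_upd_component_derivative:
  "((\<lambda>s. (x(i := s)) k) has_real_derivative (if k = i then 1 else 0)) (at t)"
  by (cases "k = i") auto

text \<open>\<open>partial\<close> is only the value of \<open>vector_derivative\<close>; this
  supplies the existence of the derivative, on which the sum and product rules below rest.\<close>

lemma hom_poly_has_partial:
  assumes "hom_poly d l F"
  shows "((\<lambda>s. F (x(i := s))) has_vector_derivative partial i F x) (at (x i))"
proof -
  from hom_poly_curve_derivative_aux[OF assms] obtain D where
    D: "\<And>\<gamma> g t. (\<forall>i\<in>{1..d+1}. ((\<lambda>t. \<gamma> t i) has_real_derivative g i) (at t)) \<Longrightarrow>
    ((\<lambda>t. F (\<gamma> t)) has_vector_derivative (\<Sum>i=1..d+1. of_real (g i) * D i (\<gamma> t))) (at t)" by metis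
  have "((\<lambda>s. F (x(i := s))) has_vector_derivative
    (\<Sum>k=1..d+1. of_real (if k = i then 1 else 0) * D k (x(i := x i)))) (at (x i))"
    by (rule D) (blast intro: fun_upd_component_derivative)
  then show ?thesis using partial_eqI by force
qed

lemma hom_poly_curve_derivative:
  assumes "hom_poly d l F"
    and "\<And>i. i \<in> {1..d+1} \<Longrightarrow> ((\<lambda>t. \<gamma> t i) has_real_derivative g i) (at t)"
  shows "((\<lambda>t. F (\<gamma> t)) has_vector_derivative (\<Sum>i=1..d+1. of_real (g i) * partial i F (\<gamma> t))) (at t)"
proof -
  from hom_poly_curve_derivative_aux[OF assms(1)] obtain D where
    D: "\<And>\<gamma> g t. (\<forall>i\<in>{1..d+1}. ((\<lambda>t. \<gamma> t i) has_real_derivative g i) (at t)) \<Longrightarrow>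
    ((\<lambda>t. F (\<gamma> t)) has_vector_derivative (\<Sum>i=1..d+1. of_real (g i) * D i (\<gamma> t))) (at t)" by metis
  \<comment> \<open>Testing the chain rule on the coordinate line through \<open>x\<close>
    identifies the unnamed gradient.\<close>
  have "partial i F x = D i x" if i: "i \<in> {1..d+1}" for i x
  proof -
    have "((\<lambda>s. F (x(i := s))) has_vector_derivative
      (\<Sum>k=1..d+1. of_real (if k = i then 1 else 0) * D k (x(i := x i)))) (at (x i))"
      by (rule D) (blast intro: fun_upd_component_derivative)
    moreover have "(\<Sum>k=1..d+1. of_real (if k = i then 1 else 0) * D k (x(i := x i))) =
      (\<Sum>k=1..d+1. if k = i then D k x else 0)" by (rule sum.cong) auto
    ultimately show ?thesis using i by (intro partial_eqI) (simp del: sum.cl_ivl_Suc)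
  qed
  then show ?thesis using D[of \<gamma> g t] assms(2) by (simp del: sum.cl_ivl_Suc)
qed

lemma partial_add:
  assumes "hom_poly d l F" "hom_poly d k G"
  shows "partial i (\<lambda>x. F x + G x) x = partial i F x + partial i G x"
  by (intro partial_eqI has_vector_derivative_add hom_poly_has_partial[OF assms(1)] hom_poly_has_partial[OF assms(2)])

lemma partial_diff:
  assumes "hom_poly d l F" "hom_poly d k G"
  shows "partial i (\<lambda>x. F x - G x) x = partial i F x - partial i G x"
  by (intro partial_eqI has_vector_derivative_diff hom_poly_has_partial[OF assms(1)] hom_poly_has_partial[OF assms(2)])

lemma partial_cmult:
  assumes "hom_poly d l F"
  shows "partial i (\<lambda>x. c * F x) x = c * partial i F x"
  by (intro partial_eqI has_vector_derivative_mult_right hom_poly_has_partial[OF assms(1)])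

lemma partial_sum:
  assumes "\<And>m. m \<in> M \<Longrightarrow> hom_poly d l (F m)"
  shows "partial i (\<lambda>x. \<Sum>m\<in>M. F m x) x = (\<Sum>m\<in>M. partial i (F m) x)"
  by (intro partial_eqI has_vector_derivative_sum) (rule hom_poly_has_partial, erule assms)

lemma partial_zero [simp]: "partial i (\<lambda>x. 0) x = 0"
  by (rule partial_eqI) simp

lemma partial_mult:
  assumes "hom_poly d l F" "hom_poly d k G"
  shows "partial i (\<lambda>x. F x * G x) x = F x * partial i G x + partial i F x * G x"
  using has_vector_derivative_mult[OF hom_poly_has_partial[OF assms(1), of x i] hom_poly_has_partial[OF assms(2), of x i]]
  by (intro partial_eqI) simp

lemma partial_cnj:
  assumes "hom_poly d l F"
  shows "partial i (\<lambda>x. cnj (F x)) x = cnj (partial i F x)"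
  by (intro partial_eqI has_vector_derivative_cnj hom_poly_has_partial[OF assms])

lemma partial_mon: "partial i (\<lambda>x. c * of_real (mon d \<alpha> x)) x = c * of_real (mon_partial d i \<alpha> x)"
proof (rule partial_eqI)
  have "((\<lambda>s. mon d \<alpha> (x(i := s))) has_real_derivative
    (\<Sum>k=1..d+1. (if k = i then 1 else 0) * mon_partial d k \<alpha> (x(i := x i)))) (at (x i))"
    by (rule mon_curve_derivative) (rule fun_upd_component_derivative)
  also have "(\<Sum>k=1..d+1. (if k = i then 1 else 0) * mon_partial d k \<alpha> (x(i := x i))) =
      (\<Sum>k=1..d+1. if k = i then mon_partial d k \<alpha> x else 0)"
    by (rule sum.cong) auto
  also have "\<dots> = mon_partial d i \<alpha> x"
    by (auto simp: mon_partial_def simp del: sum.cl_ivl_Suc)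
  finally show "((\<lambda>s. c * of_real (mon d \<alpha> (x(i := s)))) has_vector_derivative
     c * of_real (mon_partial d i \<alpha> x)) (at (x i))"
    by (intro has_vector_derivative_mult_right has_vector_derivative_of_real)
qed

lemma partial_add_mon:
  assumes "hom_poly d l F" "midx d l \<alpha>"
  shows "partial i (\<lambda>x. F x + c * of_real (mon d \<alpha> x)) x =
    partial i F x + c * of_real (mon_partial d i \<alpha> x)"
  by (subst partial_add[OF assms(1) hom_poly_mon[OF assms(2)]]) (simp only: partial_mon)

lemma midx_decr:
  assumes "midx d l \<alpha>" "i \<in> {1..d+1}" "\<alpha> i \<noteq> 0"
  shows "midx d (l - 1) (\<alpha>(i := \<alpha> i - 1))"
proof -
  have "(\<Sum>k=1..d+1. (\<alpha>(i := \<alpha> i - 1)) k) = (\<alpha> i - 1) + (\<Sum>k\<in>{1..d+1}-{i}. \<alpha> k)"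
    using assms(2) by (subst sum.remove[of _ i]) (auto intro!: sum.cong)
  moreover have "(\<Sum>k=1..d+1. \<alpha> k) = \<alpha> i + (\<Sum>k\<in>{1..d+1}-{i}. \<alpha> k)"
    using assms(2) by (subst sum.remove[of _ i]) auto
  ultimately show ?thesis using assms by (auto simp: midx_def simp del: sum.cl_ivl_Suc)
qed

text \<open>For \<open>l = 0\<close> the truncated degree \<open>l - 1\<close> is still correct: the
  derivative is zero, and zero is homogeneous of every degree.\<close>

lemma hom_poly_mon_partial:
  assumes "midx d l \<alpha>"
  shows "hom_poly d (l - 1) (\<lambda>x. c * of_real (mon_partial d i \<alpha> x))"
proof (cases "i \<in> {1..d+1} \<and> \<alpha> i \<noteq> 0")
  case True
  then show ?thesis
    using hom_poly_mon[OF midx_decr[OF assms, of i], of "c * of_nat (\<alpha> i)"]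
    by (simp add: mon_partial_def mult.assoc)
next
  case False
  then have "mon_partial d i \<alpha> x = 0" for x by (auto simp: mon_partial_def)
  then show ?thesis by simp
qed

lemma hom_poly_partial:
  assumes "hom_poly d l F"
  shows "hom_poly d (l - 1) (partial i F)"
  using assms
proof (induction rule: hom_poly_induct)
  case zero
  have "partial i (\<lambda>x. 0) = (\<lambda>x. 0)" by (rule ext) simp
  then show ?case by simp
next
  case (add_mon F c \<alpha>)
  have "partial i (\<lambda>x. F x + c * of_real (mon d \<alpha> x)) =
    (\<lambda>x. partial i F x + c * of_real (mon_partial d i \<alpha> x))"
    using add_mon by (intro ext partial_add_mon)
  then show ?case using hom_poly_add[OF hom_poly_mon_partial[OF add_mon(2)] add_mon(3)] by simp
qed

lemma mon_partial_twice:
  "partial i (\<lambda>x. c * of_real (mon_partial d j \<alpha> x)) x =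
    (if i \<in> {1..d+1} \<and> j \<in> {1..d+1} then
      c * of_nat (\<alpha> j * (\<alpha>(j := \<alpha> j - 1)) i) *
        of_real (mon d (\<alpha>(j := \<alpha> j - 1, i := (\<alpha>(j := \<alpha> j - 1)) i - 1)) x) else 0)"
proof (cases "j \<in> {1..d+1}")
  case True
  then have "(\<lambda>x. c * of_real (mon_partial d j \<alpha> x)) =
    (\<lambda>x. (c * of_nat (\<alpha> j)) * of_real (mon d (\<alpha>(j := \<alpha> j - 1)) x))"
    by (auto simp: mon_partial_def)
  then have "partial i (\<lambda>x. c * of_real (mon_partial d j \<alpha> x)) x =
    (c * of_nat (\<alpha> j)) * of_real (mon_partial d i (\<alpha>(j := \<alpha> j - 1)) x)"
    by (simp only: partial_mon)
  then show ?thesis using True by (simp add: mon_partial_def)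
next
  case False
  then have "(\<lambda>x. c * complex_of_real (mon_partial d j \<alpha> x)) = (\<lambda>x. 0)"
    by (auto simp: mon_partial_def)
  then show ?thesis using False by auto
qed

text \<open>On a monomial both orders lower the same two exponents and produce the same coefficient;
  only the order of the function updates differs.\<close>

lemma partial_commute:
  assumes "hom_poly d l F"
  shows "partial i (partial j F) x = partial j (partial i F) x"
  using assms
proof (induction rule: hom_poly_induct)
  case zero
  have "partial i (\<lambda>x. 0) = (\<lambda>x. 0)" for i by (rule ext) simp
  then show ?case by simp
next
  case (add_mon F c \<alpha>)
  have "partial i (partial j (\<lambda>x. F x + c * of_real (mon d \<alpha> x))) x =
    partial i (partial j F) x + partial i (\<lambda>x. c * of_real (mon_partial d j \<alpha> x)) x" for i j
  proof -
    have "partial j (\<lambda>x. F x + c * of_real (mon d \<alpha> x)) =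
      (\<lambda>x. partial j F x + c * of_real (mon_partial d j \<alpha> x))"
      using add_mon by (intro ext partial_add_mon)
    then show ?thesis
      using partial_add[OF hom_poly_partial[OF add_mon(1)] hom_poly_mon_partial[OF add_mon(2)]] by simp
  qed
  moreover have "partial i (\<lambda>x. c * of_real (mon_partial d j \<alpha> x)) x =
    partial j (\<lambda>x. c * of_real (mon_partial d i \<alpha> x)) x"
    unfolding mon_partial_twice by (cases "i = j") (auto simp: fun_upd_twist)
  ultimately show ?case using add_mon(3) by simp
qed

lemma mon_partial_zero: "midx d l \<alpha> \<Longrightarrow> l = 0 \<Longrightarrow> mon_partial d i \<alpha> x = 0"
  by (auto simp: midx_def mon_partial_def simp del: sum.cl_ivl_Suc)

lemma partial_degree_zero:
  assumes "hom_poly d 0 F"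
  shows "partial i F x = 0"
  using assms
proof (induction rule: hom_poly_induct)
  case (add_mon F c \<alpha>)
  then show ?case by (subst partial_add_mon) (auto simp: mon_partial_zero)
qed simp

lemma mon_euler:
  assumes "i \<in> {1..d+1}"
  shows "x i * mon_partial d i \<alpha> x = real (\<alpha> i) * mon d \<alpha> x"
proof (cases "\<alpha> i")
  case 0
  then show ?thesis by (simp add: mon_partial_def)
next
  case (Suc n)
  have "mon d \<alpha> x = x i ^ \<alpha> i * (\<Prod>k\<in>{1..d+1}-{i}. x k ^ \<alpha> k)"
    unfolding mon_def using assms by (subst prod.remove[of _ i]) auto
  moreover have "mon d (\<alpha>(i := \<alpha> i - 1)) x = x i ^ (\<alpha> i - 1) * (\<Prod>k\<in>{1..d+1}-{i}. x k ^ \<alpha> k)"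
    unfolding mon_def using assms by (subst prod.remove[of _ i]) (auto intro!: prod.cong)
  ultimately show ?thesis using assms Suc by (simp add: mon_partial_def)
qed

text \<open>Euler's identity: \<open>x i\<close> times the \<open>i\<close>-th partial derivative
  multiplies a monomial by its exponent \<open>\<alpha> i\<close>, and the exponents add up to
  \<open>l\<close>.\<close>

lemma hom_poly_euler:
  assumes "hom_poly d l F"
  shows "(\<Sum>i=1..d+1. of_real (x i) * partial i F x) = of_nat l * F x"
  using assms
proof (induction rule: hom_poly_induct)
  case (add_mon F c \<alpha>)
  have "(\<Sum>i=1..d+1. of_real (x i) * (c * of_real (mon_partial d i \<alpha> x))) =
    c * of_real (\<Sum>i=1..d+1. x i * mon_partial d i \<alpha> x)"
    by (simp add: sum_distrib_left algebra_simps del: sum.cl_ivl_Suc)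
  also have "(\<Sum>i=1..d+1. x i * mon_partial d i \<alpha> x) = (\<Sum>i=1..d+1. real (\<alpha> i)) * mon d \<alpha> x"
    unfolding sum_distrib_right by (intro sum.cong refl mon_euler)
  also have "(\<Sum>i=1..d+1. real (\<alpha> i)) = real l"
    using add_mon(2) by (simp add: midx_def del: sum.cl_ivl_Suc flip: of_nat_sum)
  finally show ?case
    using add_mon(3)
    by (simp only: partial_add_mon[OF add_mon(1,2)] distrib_left sum.distrib) simp
qed simp

lemma hom_poly_coord:
  assumes "a \<in> {1..d+1}"
  shows "hom_poly d 1 (\<lambda>x. of_real (x a))"
proof -
  let ?\<alpha> = "\<lambda>i. if i = a then 1 else (0::nat)"
  have "midx d 1 ?\<alpha>" using assms by (auto simp: midx_def simp del: sum.cl_ivl_Suc)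
  moreover have "mon d ?\<alpha> x = x a" for x
  proof -
    have "mon d ?\<alpha> x = (\<Prod>i=1..d+1. if i = a then x i else 1)"
      unfolding mon_def by (rule prod.cong) auto
    then show ?thesis using assms by (simp del: prod.cl_ivl_Suc)
  qed
  ultimately show ?thesis using hom_poly_mon[of d 1 ?\<alpha> 1] by simp
qed

section \<open>Directional derivatives, infinitesimal rotations and the Laplacian\<close>

definition dot :: "nat \<Rightarrow> (nat \<Rightarrow> real) \<Rightarrow> (nat \<Rightarrow> real) \<Rightarrow> real" where
  "dot d v w = (\<Sum>i=1..d+1. v i * w i)"

definition dir :: "nat \<Rightarrow> (nat \<Rightarrow> real) \<Rightarrow> ((nat \<Rightarrow> real) \<Rightarrow> complex) \<Rightarrow> (nat \<Rightarrow> real) \<Rightarrow> complex" where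
  "dir d v F x = (\<Sum>i=1..d+1. of_real (v i) * partial i F x)"

text \<open>The derivative along the field that maps \<open>x\<close> to
  \<open>(v . x) w - (w . x) v\<close>. This field is orthogonal to \<open>x\<close> and generates
  the rotations in the plane of \<open>v\<close> and \<open>w\<close>.\<close>

definition rot :: "nat \<Rightarrow> (nat \<Rightarrow> real) \<Rightarrow> (nat \<Rightarrow> real) \<Rightarrow> ((nat \<Rightarrow> real) \<Rightarrow> complex) \<Rightarrow> (nat \<Rightarrow> real) \<Rightarrow> complex" where
  "rot d v w F x = of_real (dot d v x) * dir d w F x - of_real (dot d w x) * dir d v F x"

lemma hom_poly_dot: "hom_poly d 1 (\<lambda>x. of_real (dot d v x))"
proof -
  have "hom_poly d 1 (\<lambda>x. \<Sum>i=1..d+1. of_real (v i) * of_real (x i))"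
    by (intro hom_poly_sum hom_poly_cmult hom_poly_coord)
  then show ?thesis by (simp add: dot_def del: sum.cl_ivl_Suc)
qed

lemma partial_dot:
  assumes "i \<in> {1..d+1}"
  shows "partial i (\<lambda>x. of_real (dot d v x)) x = of_real (v i)"
proof (rule partial_eqI)
  have "((\<lambda>s. dot d v (x(i := s))) has_real_derivative (\<Sum>k=1..d+1. v k * (if k = i then 1 else 0))) (at (x i))"
    unfolding dot_def by (intro DERIV_sum DERIV_cmult fun_upd_component_derivative)
  moreover have "(\<Sum>k=1..d+1. v k * (if k = i then 1 else 0)) = (\<Sum>k=1..d+1. if k = i then v k else 0)"
    by (rule sum.cong) auto
  moreover have "\<dots> = v i" using assms by (simp del: sum.cl_ivl_Suc)
  ultimately have "((\<lambda>s. dot d v (x(i := s))) has_real_derivative v i) (at (x i))" by metis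
  then show "((\<lambda>s. complex_of_real (dot d v (x(i := s)))) has_vector_derivative complex_of_real (v i)) (at (x i))"
    by (rule has_vector_derivative_of_real)
qed

lemma hom_poly_dir:
  assumes "hom_poly d l F"
  shows "hom_poly d (l - 1) (dir d v F)"
  unfolding dir_def by (intro hom_poly_sum hom_poly_cmult hom_poly_partial assms)

lemma hom_poly_dot_dir:
  assumes "hom_poly d l F"
  shows "hom_poly d l (\<lambda>x. of_real (dot d v x) * dir d w F x)"
\<comment> \<open>The degrees 1 and \<open>l - 1\<close> add up to \<open>l\<close> only for
  positive \<open>l\<close>; for \<open>l = 0\<close> the derivative vanishes.\<close>
proof (cases "l = 0")
  case True
  then have "dir d w F x = 0" for x
    using assms by (simp add: dir_def partial_degree_zero)
  then show ?thesis by simp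
next
  case False
  then show ?thesis
    using hom_poly_mult[OF hom_poly_dot[of d v] hom_poly_dir[OF assms, of w]] by simp
qed

lemma hom_poly_rot:
  assumes "hom_poly d l F"
  shows "hom_poly d l (rot d v w F)"
  unfolding rot_def by (intro hom_poly_diff hom_poly_dot_dir assms)

lemma partial_dir:
  assumes "hom_poly d l F"
  shows "partial i (dir d v F) x = dir d v (partial i F) x"
proof -
  have "partial i (dir d v F) x = (\<Sum>k=1..d+1. of_real (v k) * partial i (partial k F) x)"
    unfolding dir_def
    by (subst partial_sum[OF hom_poly_cmult[OF hom_poly_partial[OF assms]]])
      (intro sum.cong refl partial_cmult[OF hom_poly_partial[OF assms]])
  then show ?thesis unfolding dir_def by (simp only: partial_commute[OF assms, of i])
qed

lemma partial_dot_mult: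
  assumes "hom_poly d l G" "i \<in> {1..d+1}"
  shows "partial i (\<lambda>x. of_real (dot d v x) * G x) x = of_real (v i) * G x + of_real (dot d v x) * partial i G x"
  by (subst partial_mult[OF hom_poly_dot assms(1)]) (simp add: partial_dot[OF assms(2)])

lemma partial_rot:
  assumes "hom_poly d l F" "i \<in> {1..d+1}"
  shows "partial i (rot d v w F) x =
    of_real (v i) * dir d w F x + of_real (dot d v x) * dir d w (partial i F) x -
    (of_real (w i) * dir d v F x + of_real (dot d w x) * dir d v (partial i F) x)"
  unfolding rot_def
  by (subst partial_diff[OF hom_poly_dot_dir hom_poly_dot_dir, OF assms(1) assms(1)])
    (simp only: partial_dot_mult[OF hom_poly_dir[OF assms(1)] assms(2)] partial_dir[OF assms(1)])

lemma dir_commute: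
  assumes "hom_poly d l F"
  shows "dir d v (dir d w F) x = dir d w (dir d v F) x"
proof -
  have "dir d v (dir d w F) x = (\<Sum>i=1..d+1. \<Sum>k=1..d+1. of_real (v i) * (of_real (w k) * partial k (partial i F) x))"
    for v w
    unfolding dir_def[of d v] partial_dir[OF assms] unfolding dir_def by (simp only: sum_distrib_left)
  then show ?thesis
    apply (simp only:)
    apply (subst sum.swap)
    apply (simp only: partial_commute[OF assms] mult.left_commute)
    done
qed

text \<open>A linear form has zero second derivatives, so the Leibniz rule leaves twice the cross
  term, which is the derivative along the gradient \<open>v\<close> of the form.\<close>

lemma laplacian_dot_mult:
  assumes "hom_poly d l G"
  shows "laplacian d (\<lambda>x. of_real (dot d v x) * G x) x = 2 * dir d v G x + of_real (dot d v x) * laplacian d G x"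
proof -
  have "partial i (partial i (\<lambda>x. of_real (dot d v x) * G x)) x =
    2 * (of_real (v i) * partial i G x) + of_real (dot d v x) * partial i (partial i G) x"
    if i: "i \<in> {1..d+1}" for i
  proof -
    have "partial i (\<lambda>x. of_real (dot d v x) * G x) =
      (\<lambda>x. of_real (v i) * G x + of_real (dot d v x) * partial i G x)"
      by (intro ext partial_dot_mult[OF assms i])
    then have "partial i (partial i (\<lambda>x. of_real (dot d v x) * G x)) x =
       partial i (\<lambda>x. of_real (v i) * G x) x + partial i (\<lambda>x. of_real (dot d v x) * partial i G x) x"
      by (simp only:) (rule partial_add[OF hom_poly_cmult[OF assms] hom_poly_mult[OF hom_poly_dot hom_poly_partial[OF assms]]])
    then show ?thesis
      by (simp only: partial_cmult[OF assms] partial_dot_mult[OF hom_poly_partial[OF assms] i]) simp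
  qed
  then show ?thesis unfolding laplacian_def dir_def
    by (simp add: sum.distrib sum_distrib_left del: sum.cl_ivl_Suc)
qed

lemma laplacian_diff:
  assumes "hom_poly d l F" "hom_poly d l G"
  shows "laplacian d (\<lambda>x. F x - G x) x = laplacian d F x - laplacian d G x"
proof -
  have "partial i (\<lambda>x. F x - G x) = (\<lambda>x. partial i F x - partial i G x)" for i
    by (intro ext partial_diff[OF assms])
  then show ?thesis unfolding laplacian_def
    by (simp only: partial_diff[OF hom_poly_partial hom_poly_partial, OF assms] sum_subtractf)
qed

lemma laplacian_dir:
  assumes "hom_poly d l F"
  shows "laplacian d (dir d v F) x = dir d v (laplacian d F) x"
proof -
  have eq: "partial i (dir d v F) = dir d v (partial i F)" for i
    by (intro ext partial_dir[OF assms])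
  have "partial k (laplacian d F) x = (\<Sum>i=1..d+1. partial k (partial i (partial i F)) x)" for k
    unfolding laplacian_def by (rule partial_sum[OF hom_poly_partial[OF hom_poly_partial[OF assms]]])
  then have "dir d v (laplacian d F) x = (\<Sum>i=1..d+1. dir d v (partial i (partial i F)) x)"
    unfolding dir_def by (simp only: sum_distrib_left) (rule sum.swap)
  then show ?thesis
    unfolding laplacian_def by (simp only: eq partial_dir[OF hom_poly_partial[OF assms]])
qed

text \<open>Since the Laplacian commutes with \<open>dir\<close>, only the cross terms of the two
  products survive. They are twice the mixed second derivatives along \<open>v\<close> and
  \<open>w\<close>, in either order, and cancel.\<close>

lemma sph_harm_rot:
  assumes "P \<in> sph_harm d l"
  shows "rot d v w P \<in> sph_harm d l"
proof -
  have P: "hom_poly d l P" and "laplacian d P = (\<lambda>x. 0)"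
    using assms by (auto simp: sph_harm_def)
  then have 0: "laplacian d (dir d v P) x = 0" for v x
    by (simp add: laplacian_dir[OF P]) (simp add: dir_def)
  have "laplacian d (rot d v w P) x = 0" for x
    unfolding rot_def
    by (subst laplacian_diff[OF hom_poly_dot_dir[OF P] hom_poly_dot_dir[OF P]])
      (simp add: laplacian_dot_mult[OF hom_poly_dir[OF P]] 0 dir_commute[OF P, of w])
  then show ?thesis using hom_poly_rot[OF P] by (simp add: sph_harm_def)
qed

section \<open>Moments of the sphere\<close>

definition sincos_int :: "real \<Rightarrow> nat \<Rightarrow> nat \<Rightarrow> real" where
  "sincos_int c a b = (LINT t:{0..c}|lborel. sin t ^ a * cos t ^ b)"

lemma sincos_set_integrable: "set_integrable lborel {0..c} (\<lambda>t::real. sin t ^ a * cos t ^ b)"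
  by (intro borel_integrable_atLeastAtMost' continuous_intros)

lemma set_integral_FTC_closed:
  fixes f F :: "real \<Rightarrow> real"
  assumes "0 \<le> c" "\<And>t. (F has_real_derivative f t) (at t)" "continuous_on {0..c} f"
  shows "(LINT t:{0..c}|lborel. f t) = F c - F 0"
  unfolding set_lebesgue_integral_def using assms
  by (intro integral_FTC_atLeastAtMost)
    (auto simp: has_real_derivative_iff_has_vector_derivative intro: has_vector_derivative_at_within)

lemma sincos_int_split: "sincos_int c a b = sincos_int c (a + 2) b + sincos_int c a (b + 2)"
proof -
  have "sin t ^ a * cos t ^ b = sin t ^ (a + 2) * cos t ^ b + sin t ^ a * cos t ^ (b + 2)" for t :: real
  proof -
    have "sin t ^ (a + 2) * cos t ^ b + sin t ^ a * cos t ^ (b + 2) =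
      sin t ^ a * cos t ^ b * ((sin t)\<^sup>2 + (cos t)\<^sup>2)"
      by (simp only: power_add) algebra
    then show ?thesis by simp
  qed
  then show ?thesis unfolding sincos_int_def
    by (simp only: set_integral_add(2)[OF sincos_set_integrable sincos_set_integrable, symmetric])
qed

text \<open>The difference of the two sides is the integral of the derivative of sin^(a+1)
  cos^(b+1), which vanishes at 0 and at \<open>c\<close>. Together with
  \<open>sincos_int_split\<close> this yields the two reductions that follow.\<close>

lemma sincos_int_parts:
  assumes "0 \<le> c" "sin c = 0"
  shows "real (a + 1) * sincos_int c a (b + 2) = real (b + 1) * sincos_int c (a + 2) b"
proof -
  let ?f = "\<lambda>t. real (a + 1) * (sin t ^ a * cos t ^ (b + 2)) - real (b + 1) * (sin t ^ (a + 2) * cos t ^ b)"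
  have "(LINT t:{0..c}|lborel. ?f t) = sin c ^ (a + 1) * cos c ^ (b + 1) - sin 0 ^ (a + 1) * cos 0 ^ (b + 1)"
  proof (rule set_integral_FTC_closed)
    show "((\<lambda>t. sin t ^ (a + 1) * cos t ^ (b + 1)) has_real_derivative ?f t) (at t)" for t :: real
      by (rule derivative_eq_intros refl)+ (simp add: algebra_simps)
  qed (use assms in \<open>auto intro!: continuous_intros\<close>)
  also have "\<dots> = 0" using assms by simp
  also have "(LINT t:{0..c}|lborel. ?f t) =
    real (a + 1) * sincos_int c a (b + 2) - real (b + 1) * sincos_int c (a + 2) b"
    unfolding sincos_int_def
    by (subst set_integral_diff(2)) (simp_all only: set_integrable_mult_right sincos_set_integrable set_integral_mult_right)
  finally show ?thesis by simp
qed

lemma sincos_int_cos2: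
  assumes "0 \<le> c" "sin c = 0"
  shows "real (a + b + 2) * sincos_int c a (b + 2) = real (b + 1) * sincos_int c a b"
  using sincos_int_parts[OF assms, of a b] sincos_int_split[of c a b] by (simp add: algebra_simps)

lemma sincos_int_sin2:
  assumes "0 \<le> c" "sin c = 0"
  shows "real (a + b + 2) * sincos_int c (a + 2) b = real (a + 1) * sincos_int c a b"
  using sincos_int_parts[OF assms, of a b] sincos_int_split[of c a b] by (simp add: algebra_simps)

lemma sincos_int_cos1:
  assumes "0 \<le> c" "sin c = 0"
  shows "sincos_int c a 1 = 0"
proof -
  have "(LINT t:{0..c}|lborel. sin t ^ a * cos t ^ 1) = sin c ^ (a + 1) / real (a + 1) - sin 0 ^ (a + 1) / real (a + 1)"
  proof (rule set_integral_FTC_closed)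
    show "((\<lambda>t. sin t ^ (a + 1) / real (a + 1)) has_real_derivative (sin t ^ a * cos t ^ 1)) (at t)" for t :: real
      by (rule derivative_eq_intros refl)+ (simp_all add: field_simps del: of_nat_Suc)
  qed (use assms in \<open>auto intro!: continuous_intros\<close>)
  then show ?thesis using assms by (simp add: sincos_int_def)
qed

text \<open>The primitive takes equal values at both ends because \<open>cos c = 1\<close>. This is
  used for the first angle with \<open>c = 2 * pi\<close>; over \<open>{0..pi}\<close> the integral
  need not vanish.\<close>

lemma sincos_int_sin1:
  assumes "0 \<le> c" "cos c = 1"
  shows "sincos_int c 1 b = 0"
proof -
  have "(LINT t:{0..c}|lborel. sin t ^ 1 * cos t ^ b) = - (cos c ^ (b + 1)) / real (b + 1) - - (cos 0 ^ (b + 1)) / real (b + 1)"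
  proof (rule set_integral_FTC_closed)
    show "((\<lambda>t. - (cos t ^ (b + 1)) / real (b + 1)) has_real_derivative (sin t ^ 1 * cos t ^ b)) (at t)" for t :: real
      by (rule derivative_eq_intros refl)+ (simp_all add: field_simps del: of_nat_Suc)
  qed (use assms in \<open>auto intro!: continuous_intros\<close>)
  then show ?thesis using assms by (simp add: sincos_int_def)
qed

text \<open>The integral of the monomial \<open>\<alpha>\<close> over the sphere, as
  \<open>mon_sph_integral\<close> shows. For \<open>j\<close> at least 2, the sine of
  \<open>\<theta> j\<close> occurs in the coordinates 1 to \<open>j\<close>, and with exponent
  \<open>j - 1\<close> in the density; its cosine occurs only in coordinate
  \<open>j + 1\<close>.\<close>

definition moment :: "nat \<Rightarrow> (nat \<Rightarrow> nat) \<Rightarrow> real" where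
  "moment d \<alpha> = sincos_int (2 * pi) (\<alpha> 2) (\<alpha> 1) *
    (\<Prod>j=2..d. sincos_int pi ((\<Sum>i=1..j. \<alpha> i) + (j - 1)) (\<alpha> (j + 1)))"

lemma moment_Suc:
  assumes "1 \<le> d"
  shows "moment (Suc d) \<alpha> = moment d \<alpha> * sincos_int pi ((\<Sum>i=1..Suc d. \<alpha> i) + d) (\<alpha> (d + 2))"
  using assms by (simp add: moment_def)

lemma sum_upd_add2:
  assumes "k \<in> {1..n::nat}"
  shows "(\<Sum>i=1..n. (\<alpha>(k := \<alpha> k + 2)) i) = (\<Sum>i=1..n. \<alpha> i) + (2::nat)"
proof -
  have "(\<Sum>i=1..n. (\<alpha>(k := \<alpha> k + 2)) i) = (\<alpha> k + 2) + (\<Sum>i\<in>{1..n}-{k}. \<alpha> i)"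
    using assms by (subst sum.remove[of _ k]) (auto intro!: sum.cong)
  moreover have "(\<Sum>i=1..n. \<alpha> i) = \<alpha> k + (\<Sum>i\<in>{1..n}-{k}. \<alpha> i)"
    using assms by (subst sum.remove[of _ k]) auto
  ultimately show ?thesis by simp
qed

lemma moment_cong:
  assumes "1 \<le> d" "\<And>i. i \<in> {1..d+1} \<Longrightarrow> \<alpha> i = \<beta> i"
  shows "moment d \<alpha> = moment d \<beta>"
proof -
  have "(\<Sum>i=1..j. \<alpha> i) = (\<Sum>i=1..j. \<beta> i)" if "j \<le> d" for j
    using that assms by (intro sum.cong) auto
  then show ?thesis
    using assms unfolding moment_def by (intro arg_cong2[of _ _ _ _ "(*)"] prod.cong) auto
qed

text \<open>Induction on the dimension splits off the last angle. If \<open>k\<close> is the last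
  coordinate, only the cosine exponent of that angle grows. Otherwise its sine exponent grows by 2,
  and the factor \<open>a + 1\<close> from \<open>sincos_int_sin2\<close> is the one on the left of
  the induction hypothesis.\<close>

lemma moment_add2:
  assumes "1 \<le> d" "k \<in> {1..d+1}"
  shows "real ((\<Sum>i=1..d+1. \<alpha> i) + d + 1) * moment d (\<alpha>(k := \<alpha> k + 2)) = real (\<alpha> k + 1) * moment d \<alpha>"
  using assms
proof (induction d rule: dec_induct)
  case base
  have "k = 1 \<or> k = 2" using base by auto
  moreover have "real (\<alpha> 2 + \<alpha> 1 + 2) * sincos_int (2*pi) (\<alpha> 2) (\<alpha> 1 + 2) = real (\<alpha> 1 + 1) * sincos_int (2*pi) (\<alpha> 2) (\<alpha> 1)"
    by (rule sincos_int_cos2) auto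
  moreover have "real (\<alpha> 2 + \<alpha> 1 + 2) * sincos_int (2*pi) (\<alpha> 2 + 2) (\<alpha> 1) = real (\<alpha> 2 + 1) * sincos_int (2*pi) (\<alpha> 2) (\<alpha> 1)"
    by (rule sincos_int_sin2) auto
  moreover have "(\<Sum>i=1..1+1. \<alpha> i) + 1 + 1 = \<alpha> 2 + \<alpha> 1 + 2"
    by (simp add: numeral_2_eq_2)
  ultimately show ?case
    by (elim disjE) (simp_all only: moment_def fun_upd_same, simp_all)
next
  case (step d)
  \<comment> \<open>\<open>a\<close> is the sine exponent of the last angle,
    \<open>\<theta> (d + 1)\<close>, in \<open>moment (Suc d) \<alpha>\<close>.\<close>
  define a where "a = (\<Sum>i=1..d+1. \<alpha> i) + d"
  show ?case
  proof (cases "k = d + 2")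
    case True
    have "moment d (\<alpha>(k := \<alpha> k + 2)) = moment d \<alpha>"
      using step True by (intro moment_cong) auto
    moreover have "(\<Sum>i=1..Suc d. (\<alpha>(k := \<alpha> k + 2)) i) = (\<Sum>i=1..Suc d. \<alpha> i)"
      using True by (intro sum.cong) auto
    ultimately have m1: "moment (Suc d) (\<alpha>(k := \<alpha> k + 2)) = moment d \<alpha> * sincos_int pi a (\<alpha> k + 2)"
      using step(1) True by (simp add: moment_Suc a_def del: sum.cl_ivl_Suc)
    have m2: "moment (Suc d) \<alpha> = moment d \<alpha> * sincos_int pi a (\<alpha> k)"
      using step(1) True by (simp add: moment_Suc a_def del: sum.cl_ivl_Suc)
    have m3: "(\<Sum>i=1..Suc d+1. \<alpha> i) + Suc d + 1 = a + \<alpha> k + 2"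
      using True by (simp add: a_def)
    have m4: "real (a + \<alpha> k + 2) * sincos_int pi a (\<alpha> k + 2) = real (\<alpha> k + 1) * sincos_int pi a (\<alpha> k)"
      by (rule sincos_int_cos2) auto
    show ?thesis unfolding m1 m2 m3 using m4 by algebra
  next
    case False
    then have k: "k \<in> {1..d+1}" using step by auto
    have m1: "moment (Suc d) (\<alpha>(k := \<alpha> k + 2)) =
      moment d (\<alpha>(k := \<alpha> k + 2)) * sincos_int pi (a + 2) (\<alpha> (d + 2))"
      using step(1) False sum_upd_add2[OF k, of \<alpha>] by (simp add: moment_Suc a_def add_ac del: sum.cl_ivl_Suc fun_upd_apply) simp
    have m2: "moment (Suc d) \<alpha> = moment d \<alpha> * sincos_int pi a (\<alpha> (d + 2))"
      using step(1) by (simp add: moment_Suc a_def del: sum.cl_ivl_Suc)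
    have m3: "(\<Sum>i=1..Suc d+1. \<alpha> i) + Suc d + 1 = a + \<alpha> (d + 2) + 2"
      by (simp add: a_def)
    have m4: "real (a + \<alpha> (d + 2) + 2) * sincos_int pi (a + 2) (\<alpha> (d + 2)) = real (a + 1) * sincos_int pi a (\<alpha> (d + 2))"
      by (rule sincos_int_sin2) auto
    have m5: "real (a + 1) * moment d (\<alpha>(k := \<alpha> k + 2)) = real (\<alpha> k + 1) * moment d \<alpha>"
      using step.IH[OF k] by (simp only: a_def)
    show ?thesis unfolding m1 m2 m3 using m4 m5 by algebra
  qed
qed

text \<open>Each coordinate has one trigonometric factor whose exponent is its own: the cosine or
  sine of the first angle for coordinates 1 and 2, the cosine of angle \<open>k - 1\<close> for the
  others. With exponent 1 the integral over that angle is zero.\<close>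

lemma moment_one:
  assumes "1 \<le> d" "k \<in> {1..d+1}" "\<alpha> k = 1"
  shows "moment d \<alpha> = 0"
proof -
  consider "k = 1" | "k = 2" | "3 \<le> k" using assms by force
  then show ?thesis
  proof cases
    case 1
    then show ?thesis using assms sincos_int_cos1[of "2 * pi" "\<alpha> 2"] by (simp add: moment_def)
  next
    case 2
    then show ?thesis using assms sincos_int_sin1[of "2 * pi" "\<alpha> 1"] by (simp add: moment_def)
  next
    case 3
    then have "k - 1 \<in> {2..d}" "\<alpha> (k - 1 + 1) = 1" using assms by auto
    then have "(\<Prod>j=2..d. sincos_int pi ((\<Sum>i=1..j. \<alpha> i) + (j - 1)) (\<alpha> (j + 1))) = 0"
      using sincos_int_cos1[of pi] by (intro prod_zero bexI[of _ "k - 1"]) auto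
    then show ?thesis by (simp add: moment_def)
  qed
qed

text \<open>The two sides are the moments of \<open>x a\<close> times the \<open>b\<close>-th
  partial derivative and of \<open>x b\<close> times the \<open>a\<close>-th partial derivative of
  the monomial \<open>\<alpha>\<close>. If \<open>\<alpha> a\<close> or \<open>\<alpha> b\<close> is
  0, both sides vanish, one of them by \<open>moment_one\<close>. Otherwise both arise from one
  exponent vector \<open>\<beta>\<close> by raising one entry by 2, and \<open>moment_add2\<close>
  compares them.\<close>

lemma moment_rotate:
  assumes "1 \<le> d" "a \<in> {1..d+1}" "b \<in> {1..d+1}" "a \<noteq> b"
  shows "real (\<alpha> b) * moment d (\<alpha>(b := \<alpha> b - 1, a := \<alpha> a + 1)) =
    real (\<alpha> a) * moment d (\<alpha>(a := \<alpha> a - 1, b := \<alpha> b + 1))"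
proof -
  consider "\<alpha> a = 0" | "\<alpha> b = 0" | "\<alpha> a > 0" "\<alpha> b > 0" by auto
  then show ?thesis
  proof cases
    case 1
    then show ?thesis using assms by (simp add: moment_one[of d a])
  next
    case 2
    then show ?thesis using assms by (simp add: moment_one[of d b])
  next
    case 3
    define \<beta> where "\<beta> = \<alpha>(a := \<alpha> a - 1, b := \<alpha> b - 1)"
    have 1: "\<alpha>(b := \<alpha> b - 1, a := \<alpha> a + 1) = \<beta>(a := \<beta> a + 2)"
      and 2: "\<alpha>(a := \<alpha> a - 1, b := \<alpha> b + 1) = \<beta>(b := \<beta> b + 2)"
      using 3 assms(4) by (auto simp: \<beta>_def fun_eq_iff)
    have 3: "\<alpha> a = \<beta> a + 1" "\<alpha> b = \<beta> b + 1" using 3 assms(4) by (auto simp: \<beta>_def)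
    let ?S = "real ((\<Sum>i=1..d+1. \<beta> i) + d + 1)"
    have "?S * (real (\<alpha> b) * moment d (\<beta>(a := \<beta> a + 2))) = ?S * (real (\<alpha> a) * moment d (\<beta>(b := \<beta> b + 2)))"
      using moment_add2[OF assms(1,2), of \<beta>] moment_add2[OF assms(1,3), of \<beta>]
      by (metis 3 mult.left_commute)
    then show ?thesis unfolding 1 2 by (simp del: sum.cl_ivl_Suc of_nat_add)
  qed
qed

section \<open>Skew-symmetry of infinitesimal rotations\<close>

lemma mon_sph_prefix:
  assumes "1 \<le> m" "m \<le> d"
  shows "(\<Prod>k=1..m+1. sph d \<theta> k ^ \<alpha> k) =
    (\<Prod>i=m+1..d. sin (\<theta> i)) ^ (\<Sum>i=1..m+1. \<alpha> i) * (sin (\<theta> 1) ^ \<alpha> 2 * cos (\<theta> 1) ^ \<alpha> 1) *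
    (\<Prod>j=2..m. sin (\<theta> j) ^ (\<Sum>i=1..j. \<alpha> i) * cos (\<theta> j) ^ \<alpha> (j + 1))"
  using assms
proof (induction m rule: dec_induct)
  case base
  have "(\<Prod>k=1..1+1. sph d \<theta> k ^ \<alpha> k) = sph d \<theta> 1 ^ \<alpha> 1 * sph d \<theta> 2 ^ \<alpha> 2"
    by (simp add: numeral_2_eq_2)
  also have "\<dots> = (\<Prod>i=2..d. sin (\<theta> i)) ^ (\<alpha> 1 + \<alpha> 2) * (sin (\<theta> 1) ^ \<alpha> 2 * cos (\<theta> 1) ^ \<alpha> 1)"
    by (simp add: sph_def power_add power_mult_distrib)
  finally show ?case by (simp add: numeral_2_eq_2)
next
  case (step m)
  \<comment> \<open>The first \<open>m + 1\<close> coordinates share the product of the sines of the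
    angles beyond \<open>m\<close>. The step splits the sine of angle \<open>m + 1\<close> off this
    product and leaves \<open>P\<close>, the common factor for one more coordinate.\<close>
  define P where "P = (\<Prod>i=m+2..d. sin (\<theta> i))"
  have 1: "(\<Prod>i=m+1..d. sin (\<theta> i)) = sin (\<theta> (m + 1)) * P"
    using step.prems by (simp add: P_def prod.atLeast_Suc_atMost)
  have 2: "sph d \<theta> (m + 2) = P * cos (\<theta> (m + 1))"
    using step by (simp add: sph_def P_def)
  have 3: "(\<Prod>k=1..Suc m+1. sph d \<theta> k ^ \<alpha> k) = (\<Prod>k=1..m+1. sph d \<theta> k ^ \<alpha> k) * sph d \<theta> (m + 2) ^ \<alpha> (m + 2)"
    by simp
  have 4: "(\<Sum>i=1..Suc m+1. \<alpha> i) = (\<Sum>i=1..m+1. \<alpha> i) + \<alpha> (m + 2)"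
    by simp
  have 5: "(\<Prod>j=2..Suc m. sin (\<theta> j) ^ (\<Sum>i=1..j. \<alpha> i) * cos (\<theta> j) ^ \<alpha> (j + 1)) =
    (\<Prod>j=2..m. sin (\<theta> j) ^ (\<Sum>i=1..j. \<alpha> i) * cos (\<theta> j) ^ \<alpha> (j + 1)) *
    (sin (\<theta> (m + 1)) ^ (\<Sum>i=1..m+1. \<alpha> i) * cos (\<theta> (m + 1)) ^ \<alpha> (m + 2))"
    using step(1) by simp
  have 6: "(\<Prod>i=Suc m+1..d. sin (\<theta> i)) = P" by (simp add: P_def)
  have IH: "(\<Prod>k=1..m+1. sph d \<theta> k ^ \<alpha> k) =
    (\<Prod>i=m+1..d. sin (\<theta> i)) ^ (\<Sum>i=1..m+1. \<alpha> i) * (sin (\<theta> 1) ^ \<alpha> 2 * cos (\<theta> 1) ^ \<alpha> 1) *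
    (\<Prod>j=2..m. sin (\<theta> j) ^ (\<Sum>i=1..j. \<alpha> i) * cos (\<theta> j) ^ \<alpha> (j + 1))"
    using step by simp
  show ?case unfolding 3 IH 4 5 6 1 2 power_mult_distrib power_add by (simp only: mult_ac)
qed

text \<open>The part of indicator, monomial and density that depends on angle \<open>j\<close>
  alone, so that the integral over the product measure becomes a product of integrals.\<close>

definition angle_factor :: "(nat \<Rightarrow> nat) \<Rightarrow> nat \<Rightarrow> real \<Rightarrow> real" where
  "angle_factor \<alpha> j t = (if j = 1 then indicator {0..<2*pi} t * (sin t ^ \<alpha> 2 * cos t ^ \<alpha> 1)
     else indicator {0..pi} t * (sin t ^ ((\<Sum>i=1..j. \<alpha> i) + (j - 1)) * cos t ^ \<alpha> (j + 1)))"

lemma prod_split_first: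
  fixes f :: "nat \<Rightarrow> real"
  assumes "1 \<le> d"
  shows "(\<Prod>j=1..d. f j) = f 1 * (\<Prod>j=2..d. f j)"
  using assms by (simp add: prod.atLeast_Suc_atMost numeral_2_eq_2)

lemma mon_sph_factor:
  assumes "1 \<le> d"
  shows "indicator (angle_dom d) \<theta> * (mon d \<alpha> (sph d \<theta>) * sph_weight d \<theta>) = (\<Prod>j=1..d. angle_factor \<alpha> j (\<theta> j))"
proof -
  have ind: "(indicator (angle_dom d) \<theta> :: real) = indicator {0..<2*pi} (\<theta> 1) * (\<Prod>j=2..d. indicator {0..pi} (\<theta> j))"
  proof (cases "\<theta> \<in> angle_dom d")
    case True
    then show ?thesis by (auto simp: angle_dom_def)
  next
    case False
    then consider "\<theta> 1 \<notin> {0..<2*pi}" | j where "j \<in> {2..d}" "\<theta> j \<notin> {0..pi}"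
      by (auto simp: angle_dom_def)
    then show ?thesis
    proof cases
      case 1
      then show ?thesis using False by simp
    next
      case 2
      then have "(\<Prod>j=2..d. indicator {0..pi} (\<theta> j) :: real) = 0"
        by (intro prod_zero) (auto intro!: bexI[of _ j])
      then show ?thesis using False by simp
    qed
  qed
  have "mon d \<alpha> (sph d \<theta>) = (sin (\<theta> 1) ^ \<alpha> 2 * cos (\<theta> 1) ^ \<alpha> 1) *
    (\<Prod>j=2..d. sin (\<theta> j) ^ (\<Sum>i=1..j. \<alpha> i) * cos (\<theta> j) ^ \<alpha> (j + 1))"
    unfolding mon_def using mon_sph_prefix[OF assms order_refl, of \<theta> \<alpha>] by simp
  then have "indicator (angle_dom d) \<theta> * (mon d \<alpha> (sph d \<theta>) * sph_weight d \<theta>) =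
    indicator {0..<2*pi} (\<theta> 1) * (sin (\<theta> 1) ^ \<alpha> 2 * cos (\<theta> 1) ^ \<alpha> 1) *
    ((\<Prod>j=2..d. indicator {0..pi} (\<theta> j)) *
     ((\<Prod>j=2..d. sin (\<theta> j) ^ (\<Sum>i=1..j. \<alpha> i) * cos (\<theta> j) ^ \<alpha> (j + 1)) * (\<Prod>j=2..d. sin (\<theta> j) ^ (j - 1))))"
    unfolding ind sph_weight_def by (simp only: mult_ac)
  also have "\<dots> = angle_factor \<alpha> 1 (\<theta> 1) * (\<Prod>j=2..d. angle_factor \<alpha> j (\<theta> j))"
    unfolding prod.distrib[symmetric]
  proof (intro arg_cong2[of _ _ _ _ "(*)"] prod.cong refl)
    fix j assume "j \<in> {2..d}"
    then have "j \<noteq> 1" by simp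
    then show "indicator {0..pi} (\<theta> j) * (sin (\<theta> j) ^ (\<Sum>i=1..j. \<alpha> i) * cos (\<theta> j) ^ \<alpha> (j + 1) *
      sin (\<theta> j) ^ (j - 1)) = angle_factor \<alpha> j (\<theta> j)"
      unfolding angle_factor_def power_add by (simp only: if_False mult_ac)
  qed (simp add: angle_factor_def)
  finally show ?thesis unfolding prod_split_first[OF assms] .
qed

text \<open>Bridges the half-open range of the first angle in \<open>angle_dom\<close> and the
  closed interval in \<open>sincos_int\<close>.\<close>

lemma AE_indicator_half_open:
  fixes c :: real
  shows "AE t in lborel. (indicator {0..<c} t :: real) = indicator {0..c} t"
  using AE_lborel_singleton[of c] by eventually_elim (auto simp: indicator_def)

lemma angle_factor_integrable: "integrable lborel (angle_factor \<alpha> j)"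
proof (cases "j = 1")
  case True
  have "integrable lborel (\<lambda>t. indicator {0..2*pi} t * (sin t ^ \<alpha> 2 * cos t ^ \<alpha> 1))"
    using sincos_set_integrable[of "2*pi" "\<alpha> 2" "\<alpha> 1"] by (simp add: set_integrable_def)
  then have "integrable lborel (\<lambda>t. indicator {0..<2*pi} t * (sin t ^ \<alpha> 2 * cos t ^ \<alpha> 1))"
    by (rule integrable_cong_AE_imp, measurable) (use AE_indicator_half_open[of "2*pi"] in eventually_elim, simp)
  then show ?thesis using True by (simp add: angle_factor_def[abs_def])
next
  case False
  then show ?thesis
    using sincos_set_integrable[of pi "(\<Sum>i=1..j. \<alpha> i) + (j - 1)" "\<alpha> (j + 1)"]
    by (simp add: angle_factor_def[abs_def] set_integrable_def)
qed

lemma angle_factor_integral: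
  "integral\<^sup>L lborel (angle_factor \<alpha> j) = (if j = 1 then sincos_int (2*pi) (\<alpha> 2) (\<alpha> 1)
    else sincos_int pi ((\<Sum>i=1..j. \<alpha> i) + (j - 1)) (\<alpha> (j + 1)))"
proof (cases "j = 1")
  case True
  have "integral\<^sup>L lborel (\<lambda>t. indicator {0..<2*pi} t * (sin t ^ \<alpha> 2 * cos t ^ \<alpha> 1)) =
    integral\<^sup>L lborel (\<lambda>t. indicator {0..2*pi} t * (sin t ^ \<alpha> 2 * cos t ^ \<alpha> 1))"
    by (rule integral_cong_AE, measurable) (use AE_indicator_half_open[of "2*pi"] in eventually_elim, simp)
  then show ?thesis using True
    by (simp add: angle_factor_def[abs_def] sincos_int_def set_lebesgue_integral_def)
next
  case False
  then show ?thesis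
    by (simp add: angle_factor_def[abs_def] sincos_int_def set_lebesgue_integral_def)
qed

interpretation lborel_product: product_sigma_finite "\<lambda>_::nat. lborel :: real measure" ..

lemma mon_sph_integrable:
  assumes "1 \<le> d"
  shows "set_integrable (angle_measure d) (angle_dom d) (\<lambda>\<theta>. mon d \<alpha> (sph d \<theta>) * sph_weight d \<theta>)"
  unfolding set_integrable_def angle_measure_def real_scaleR_def mon_sph_factor[OF assms]
  by (intro lborel_product.product_integrable_prod angle_factor_integrable) simp

lemma mon_sph_integral:
  assumes "1 \<le> d"
  shows "(LINT \<theta>:angle_dom d|angle_measure d. mon d \<alpha> (sph d \<theta>) * sph_weight d \<theta>) = moment d \<alpha>"
proof -
  have "(LINT \<theta>:angle_dom d|angle_measure d. mon d \<alpha> (sph d \<theta>) * sph_weight d \<theta>) =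
    (\<Prod>j=1..d. integral\<^sup>L lborel (angle_factor \<alpha> j))"
    unfolding set_lebesgue_integral_def angle_measure_def real_scaleR_def mon_sph_factor[OF assms]
    by (intro lborel_product.product_integral_prod angle_factor_integrable) simp
  also have "\<dots> = moment d \<alpha>"
    unfolding prod_split_first[OF assms] moment_def
    by (intro arg_cong2[of _ _ _ _ "(*)"] prod.cong) (auto simp: angle_factor_integral)
  finally show ?thesis .
qed

section \<open>Integration of homogeneous polynomials over the sphere\<close>

definition sph_integral :: "nat \<Rightarrow> ((nat \<Rightarrow> real) \<Rightarrow> complex) \<Rightarrow> complex" where
  "sph_integral d F = (LINT \<theta>:angle_dom d|angle_measure d. F (sph d \<theta>) * of_real (sph_weight d \<theta>))"

definition sph_integrable :: "nat \<Rightarrow> ((nat \<Rightarrow> real) \<Rightarrow> complex) \<Rightarrow> bool" where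
  "sph_integrable d F \<longleftrightarrow> set_integrable (angle_measure d) (angle_dom d) (\<lambda>\<theta>. F (sph d \<theta>) * of_real (sph_weight d \<theta>))"

lemma sph_inner_eq: "sph_inner d f g = sph_integral d (\<lambda>x. f x * cnj (g x))"
  by (simp add: sph_inner_def sph_integral_def)

lemma sph_integral_add:
  assumes "sph_integrable d F" "sph_integrable d G"
  shows "sph_integral d (\<lambda>x. F x + G x) = sph_integral d F + sph_integral d G"
    and "sph_integrable d (\<lambda>x. F x + G x)"
  using assms unfolding sph_integral_def sph_integrable_def distrib_right
  by (auto simp only: set_integral_add)

lemma sph_integral_cmult:
  "sph_integral d (\<lambda>x. c * F x) = c * sph_integral d F"
  unfolding sph_integral_def mult.assoc by (rule set_integral_mult_right)

lemma sph_integrable_cmult: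
  "sph_integrable d F \<Longrightarrow> sph_integrable d (\<lambda>x. c * F x)"
  unfolding sph_integrable_def mult.assoc by (rule set_integrable_mult_right)

lemma sph_integral_mon:
  assumes "1 \<le> d"
  shows "sph_integral d (\<lambda>x. c * of_real (mon d \<alpha> x)) = c * of_real (moment d \<alpha>)"
    and "sph_integrable d (\<lambda>x. c * of_real (mon d \<alpha> x))"
proof -
  have "sph_integral d (\<lambda>x. of_real (mon d \<alpha> x)) = of_real (moment d \<alpha>)"
    unfolding sph_integral_def mon_sph_integral[OF assms, symmetric]
    by (simp flip: of_real_mult add: set_integral_complex_of_real)
  then show "sph_integral d (\<lambda>x. c * of_real (mon d \<alpha> x)) = c * of_real (moment d \<alpha>)"
    by (simp add: sph_integral_cmult)
  have "sph_integrable d (\<lambda>x. of_real (mon d \<alpha> x))"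
    using integrable_of_real[OF mon_sph_integrable[OF assms, of \<alpha>, unfolded set_integrable_def], where ?'a = complex]
    unfolding sph_integrable_def set_integrable_def by (simp add: scaleR_conv_of_real)
  then show "sph_integrable d (\<lambda>x. c * of_real (mon d \<alpha> x))"
    by (rule sph_integrable_cmult)
qed

lemma hom_poly_sph_integrable:
  assumes "hom_poly d l F" "1 \<le> d"
  shows "sph_integrable d F"
  using assms(1)
proof (induction rule: hom_poly_induct)
  case zero
  show ?case by (simp add: sph_integrable_def set_integrable_def)
next
  case (add_mon F c \<alpha>)
  then show ?case by (intro sph_integral_add(2) sph_integral_mon(2) assms(2))
qed

lemma sph_integral_sum:
  assumes "\<And>m. m \<in> M \<Longrightarrow> hom_poly d l (F m)" "1 \<le> d"
  shows "sph_integral d (\<lambda>x. \<Sum>m\<in>M. F m x) = (\<Sum>m\<in>M. sph_integral d (F m))"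
  using assms(1)
proof (induction M rule: infinite_finite_induct)
  case (insert m M)
  then have "hom_poly d l (\<lambda>x. \<Sum>m\<in>M. F m x)" by (intro hom_poly_sum) auto
  with insert show ?case
    using sph_integral_add(1)[of d "F m" "\<lambda>x. \<Sum>m\<in>M. F m x"] hom_poly_sph_integrable[OF _ assms(2)]
    by auto
qed (auto simp: sph_integral_def)

section \<open>Infinitesimal rotations integrate to zero\<close>

lemma coord_mon_partial:
  assumes "a \<in> {1..d+1}" "b \<in> {1..d+1}" "a \<noteq> b"
  shows "x a * mon_partial d b \<alpha> x = real (\<alpha> b) * mon d (\<alpha>(b := \<alpha> b - 1, a := \<alpha> a + 1)) x"
proof -
  let ?\<beta> = "\<alpha>(b := \<alpha> b - 1)"
  have "mon d (?\<beta>(a := \<alpha> a + 1)) x = x a ^ (\<alpha> a + 1) * (\<Prod>k\<in>{1..d+1}-{a}. x k ^ ?\<beta> k)"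
    unfolding mon_def using assms by (subst prod.remove[of _ a]) (auto intro!: prod.cong)
  moreover have "mon d ?\<beta> x = x a ^ \<alpha> a * (\<Prod>k\<in>{1..d+1}-{a}. x k ^ ?\<beta> k)"
    unfolding mon_def using assms by (subst prod.remove[of _ a]) auto
  ultimately show ?thesis using assms by (simp add: mon_partial_def)
qed

text \<open>The case of \<open>rot\<close> for two coordinate axes. It turns a monomial into a
  combination of two monomials, so its integral can be read off from \<open>moment\<close>;
  \<open>rot_eq_coord_rot\<close> recovers the general case by bilinearity.\<close>

definition coord_rot :: "nat \<Rightarrow> nat \<Rightarrow> ((nat \<Rightarrow> real) \<Rightarrow> complex) \<Rightarrow> (nat \<Rightarrow> real) \<Rightarrow> complex" where
  "coord_rot a b F x = of_real (x a) * partial b F x - of_real (x b) * partial a F x"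

lemma hom_poly_coord_partial:
  assumes "hom_poly d l F" "a \<in> {1..d+1}"
  shows "hom_poly d l (\<lambda>x. of_real (x a) * partial b F x)"
proof (cases "l = 0")
  case True
  then show ?thesis using assms by (simp add: partial_degree_zero)
next
  case False
  then show ?thesis
    using hom_poly_mult[OF hom_poly_coord[OF assms(2)] hom_poly_partial[OF assms(1), of b]] by simp
qed

lemma hom_poly_coord_rot:
  assumes "hom_poly d l F" "a \<in> {1..d+1}" "b \<in> {1..d+1}"
  shows "hom_poly d l (coord_rot a b F)"
  unfolding coord_rot_def by (intro hom_poly_diff hom_poly_coord_partial assms)

text \<open>By linearity a single monomial is enough, and its two image terms cancel by
  \<open>moment_rotate\<close>.\<close>

lemma sph_integral_coord_rot:
  assumes "hom_poly d l F" "a \<in> {1..d+1}" "b \<in> {1..d+1}" "1 \<le> d"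
  shows "sph_integral d (coord_rot a b F) = 0"
proof (cases "a = b")
  case True
  then show ?thesis by (simp add: sph_integral_def coord_rot_def)
next
  case False
  show ?thesis using assms(1)
  proof (induction rule: hom_poly_induct)
    case zero
    then show ?case by (simp add: sph_integral_def coord_rot_def)
  next
    case (add_mon F c \<alpha>)
    let ?B = "\<alpha>(b := \<alpha> b - 1, a := \<alpha> a + 1)" and ?A = "\<alpha>(a := \<alpha> a - 1, b := \<alpha> b + 1)"
    have "coord_rot a b (\<lambda>x. F x + c * of_real (mon d \<alpha> x)) x =
      coord_rot a b F x + (c * of_nat (\<alpha> b) * of_real (mon d ?B x) + - c * of_nat (\<alpha> a) * of_real (mon d ?A x))" for x
    proof -
      have "coord_rot a b (\<lambda>x. F x + c * of_real (mon d \<alpha> x)) x =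
        coord_rot a b F x + (c * of_real (x a * mon_partial d b \<alpha> x) - c * of_real (x b * mon_partial d a \<alpha> x))"
        unfolding coord_rot_def partial_add_mon[OF add_mon(1,2)] by (simp add: algebra_simps)
      then show ?thesis
        unfolding coord_mon_partial[OF assms(2,3) False] coord_mon_partial[OF assms(3,2) False[symmetric]]
        by simp
    qed
    then have "sph_integral d (coord_rot a b (\<lambda>x. F x + c * of_real (mon d \<alpha> x))) =
      sph_integral d (\<lambda>x. coord_rot a b F x +
        (c * of_nat (\<alpha> b) * of_real (mon d ?B x) + - c * of_nat (\<alpha> a) * of_real (mon d ?A x)))"
      by presburger
    also have "\<dots> = sph_integral d (coord_rot a b F) +
      (c * of_nat (\<alpha> b) * of_real (moment d ?B) + - c * of_nat (\<alpha> a) * of_real (moment d ?A))"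
      using hom_poly_sph_integrable[OF hom_poly_coord_rot[OF add_mon(1) assms(2,3)] assms(4)]
      by (simp only: sph_integral_add sph_integral_mon[OF assms(4)])
    also have "\<dots> = c * of_real (real (\<alpha> b) * moment d ?B - real (\<alpha> a) * moment d ?A)"
      using add_mon(3) by (simp add: algebra_simps)
    also have "\<dots> = 0" using moment_rotate[OF assms(4,2,3) False, of \<alpha>] by simp
    finally show ?case .
  qed
qed

lemma rot_eq_coord_rot:
  "rot d v w F x = (\<Sum>a=1..d+1. \<Sum>b=1..d+1. of_real (v a * w b) * coord_rot a b F x)"
proof -
  have "(\<Sum>a=1..d+1. \<Sum>b=1..d+1. of_real (v a * w b) * coord_rot a b F x) =
    (\<Sum>a=1..d+1. \<Sum>b=1..d+1. of_real (v a * x a) * (of_real (w b) * partial b F x)) -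
    (\<Sum>a=1..d+1. \<Sum>b=1..d+1. (of_real (v a) * partial a F x) * of_real (w b * x b))"
    unfolding coord_rot_def right_diff_distrib sum_subtractf by (simp only: of_real_mult mult_ac)
  also have "\<dots> = rot d v w F x"
    unfolding rot_def dir_def dot_def of_real_sum sum_product[symmetric] by (simp only: mult.commute)
  finally show ?thesis by simp
qed

lemma sph_integral_rot:
  assumes "hom_poly d l F" "1 \<le> d"
  shows "sph_integral d (rot d v w F) = 0"
proof -
  have hom: "hom_poly d l (\<lambda>x. of_real (v a * w b) * coord_rot a b F x)"
    if "a \<in> {1..d+1}" "b \<in> {1..d+1}" for a b
    using that by (intro hom_poly_cmult hom_poly_coord_rot assms)
  have "sph_integral d (rot d v w F) =
    (\<Sum>a=1..d+1. sph_integral d (\<lambda>x. \<Sum>b=1..d+1. of_real (v a * w b) * coord_rot a b F x))"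
    unfolding rot_eq_coord_rot[abs_def]
    by (rule sph_integral_sum[OF hom_poly_sum assms(2)]) (rule hom)
  also have "\<dots> = (\<Sum>a=1..d+1. \<Sum>b=1..d+1. sph_integral d (\<lambda>x. of_real (v a * w b) * coord_rot a b F x))"
    by (intro sum.cong refl, rule sph_integral_sum[OF hom assms(2)])
  also have "\<dots> = 0"
    by (intro sum.neutral ballI) (simp only: sph_integral_cmult sph_integral_coord_rot[OF assms(1) _ _ assms(2)] mult_zero_right)
  finally show ?thesis .
qed

lemma dir_mult_cnj:
  assumes "hom_poly d l P" "hom_poly d k Q"
  shows "dir d v (\<lambda>x. P x * cnj (Q x)) x = dir d v P x * cnj (Q x) + P x * cnj (dir d v Q x)"
proof -
  have "partial i (\<lambda>x. P x * cnj (Q x)) x = P x * cnj (partial i Q x) + partial i P x * cnj (Q x)" for i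
    by (subst partial_mult[OF assms(1) hom_poly_cnj[OF assms(2)]]) (simp only: partial_cnj[OF assms(2)])
  then show ?thesis
    by (simp add: dir_def sum_distrib_left sum_distrib_right sum.distrib algebra_simps del: sum.cl_ivl_Suc)
qed

text \<open>\<open>rot\<close> is a derivation with real coefficients, hence commutes with
  conjugation. Applied to the product of \<open>P\<close> and the conjugate of \<open>Q\<close> it
  gives the two inner products, and its integral is zero.\<close>

lemma sph_inner_rot:
  assumes "hom_poly d l P" "hom_poly d l Q" "1 \<le> d"
  shows "sph_inner d (rot d v w P) Q = - sph_inner d P (rot d v w Q)"
proof -
  have "rot d v w (\<lambda>x. P x * cnj (Q x)) x = rot d v w P x * cnj (Q x) + P x * cnj (rot d v w Q x)" for x
    unfolding rot_def dir_mult_cnj[OF assms(1,2)] by (simp add: algebra_simps)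
  then have "sph_integral d (rot d v w (\<lambda>x. P x * cnj (Q x))) =
    sph_integral d (\<lambda>x. rot d v w P x * cnj (Q x) + P x * cnj (rot d v w Q x))" by presburger
  also have "\<dots> = sph_inner d (rot d v w P) Q + sph_inner d P (rot d v w Q)"
    unfolding sph_inner_eq
    by (rule sph_integral_add(1)[OF
          hom_poly_sph_integrable[OF hom_poly_mult[OF hom_poly_rot[OF assms(1)] hom_poly_cnj[OF assms(2)]] assms(3)]
          hom_poly_sph_integrable[OF hom_poly_mult[OF assms(1) hom_poly_cnj[OF hom_poly_rot[OF assms(2)]]] assms(3)]])
  finally show ?thesis
    using sph_integral_rot[OF hom_poly_mult[OF assms(1) hom_poly_cnj[OF assms(2)]] assms(3)]
    by (simp add: add_eq_0_iff)
qed

section \<open>Geometry of hyperspherical coordinates\<close>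

text \<open>Adding one more coordinate turns the sine square of angle \<open>m + 1\<close> into sine
  square plus cosine square. The case \<open>m = d\<close> gives unit length; the smaller
  \<open>m\<close> give the lengths of the coordinate velocities.\<close>

lemma sph_square_prefix:
  assumes "1 \<le> m" "m \<le> d"
  shows "(\<Sum>k=1..m+1. (sph d \<theta> k)\<^sup>2) = (eta d m \<theta>)\<^sup>2"
  using assms
proof (induction m rule: dec_induct)
  case base
  have "(\<Sum>k=1..2. (sph d \<theta> k)\<^sup>2) = (sph d \<theta> 1)\<^sup>2 + (sph d \<theta> 2)\<^sup>2"
    by (simp add: numeral_2_eq_2)
  also have "\<dots> = (\<Prod>i=2..d. sin (\<theta> i))\<^sup>2 * ((sin (\<theta> 1))\<^sup>2 + (cos (\<theta> 1))\<^sup>2)"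
    by (simp add: sph_def power_mult_distrib distrib_left del: sin_cos_squared_add)
  finally show ?case unfolding eta_def one_add_one by simp
next
  case (step m)
  define P where "P = eta d (m + 1) \<theta>"
  have 1: "eta d m \<theta> = sin (\<theta> (m + 1)) * P"
    using step.prems by (simp add: P_def eta_def prod.atLeast_Suc_atMost)
  have 2: "sph d \<theta> (m + 2) = P * cos (\<theta> (m + 1))"
    using step by (simp add: sph_def P_def eta_def)
  have "(\<Sum>k=1..Suc m+1. (sph d \<theta> k)\<^sup>2) = (eta d m \<theta>)\<^sup>2 + (sph d \<theta> (m + 2))\<^sup>2"
    using step by simp
  also have "\<dots> = P\<^sup>2 * ((sin (\<theta> (m + 1)))\<^sup>2 + (cos (\<theta> (m + 1)))\<^sup>2)"
    unfolding 1 2 by algebra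
  finally show ?case by (simp add: P_def)
qed

lemma sph_dot_self:
  assumes "1 \<le> d"
  shows "dot d (sph d \<theta>) (sph d \<theta>) = 1"
  using sph_square_prefix[OF assms order_refl, of \<theta>]
  by (simp add: dot_def eta_def power2_eq_square del: sum.cl_ivl_Suc)

lemma prod_sin_upd_derivative:
  assumes "j \<in> {a..d::nat}"
  shows "((\<lambda>t. \<Prod>i=a..d. sin ((\<theta>(j := t)) i)) has_real_derivative
    (\<Prod>i=a..d. sin ((\<theta>(j := t + pi / 2)) i))) (at t)"
proof -
  have "(\<Prod>i=a..d. sin ((\<theta>(j := s)) i)) = sin s * (\<Prod>i\<in>{a..d}-{j}. sin (\<theta> i))" for s
    using assms by (subst prod.remove[of _ j]) auto
  then show ?thesis by (auto intro!: derivative_eq_intros simp: sin_add)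
qed

lemma prod_sin_upd:
  assumes "j \<notin> {a..d::nat}"
  shows "(\<Prod>i=a..d. sin ((\<theta>(j := t)) i)) = (\<Prod>i=a..d. sin (\<theta> i))"
  using assms by (intro prod.cong) auto

lemma sph_1: "sph d \<theta> 1 = (\<Prod>i=2..d. sin (\<theta> i)) * cos (\<theta> 1)"
  by (simp add: sph_def)

lemma sph_2: "sph d \<theta> 2 = (\<Prod>i=2..d. sin (\<theta> i)) * sin (\<theta> 1)"
  by (simp add: sph_def)

lemma sph_ge3: "3 \<le> k \<Longrightarrow> k \<le> d + 1 \<Longrightarrow> sph d \<theta> k = (\<Prod>i=k..d. sin (\<theta> i)) * cos (\<theta> (k - 1))"
  by (simp add: sph_def)

text \<open>A quarter turn in \<open>\<theta>\<^sub>j\<close> differentiates the coordinates that depend on \<open>\<theta>\<^sub>j\<close>.\<close>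

lemma sph_upd_derivative:
  assumes j: "j \<in> {1..d}"
  shows "((\<lambda>t. sph d (\<theta>(j := t)) k) has_real_derivative
    (if k \<le> j + 1 then sph d (\<theta>(j := t + pi / 2)) k else 0)) (at t)"
proof -
  have DP: "((\<lambda>t. (\<Prod>i=a..d. sin ((\<theta>(j := t)) i)) * c) has_real_derivative
    (\<Prod>i=a..d. sin ((\<theta>(j := t + pi / 2)) i)) * c) (at t)" if "j \<in> {a..d}" for a c
    by (intro DERIV_cmult_right prod_sin_upd_derivative that)
  have Dcos: "((\<lambda>t. c * cos t) has_real_derivative c * cos (t + pi / 2)) (at t)" for c :: real
    by (auto intro!: derivative_eq_intros simp: cos_add)
  have Dsin: "((\<lambda>t. c * sin t) has_real_derivative c * sin (t + pi / 2)) (at t)" for c :: real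
    by (auto intro!: derivative_eq_intros simp: sin_add)
  consider "k = 0 \<or> k > d + 1" | "k = 1" | "k = 2" | "3 \<le> k" "k \<le> d + 1" by linarith
  then show ?thesis
  proof cases
    case 1
    then show ?thesis using j by (auto simp: sph_def)
  next
    case 2
    then have kj: "k \<le> j + 1" using j by simp
    show ?thesis
    proof (cases "j = 1")
      case True
      then have "j \<notin> {2..d}" by simp
      then have eq: "sph d (\<theta>(j := s)) k = (\<Prod>i=2..d. sin (\<theta> i)) * cos s" for s
        unfolding 2 sph_1 prod_sin_upd[OF \<open>j \<notin> {2..d}\<close>] using True by (simp only: fun_upd_same)
      show ?thesis unfolding eq if_P[OF kj] by (rule Dcos)
    next
      case False
      then have eq: "sph d (\<theta>(j := s)) k = (\<Prod>i=2..d. sin ((\<theta>(j := s)) i)) * cos (\<theta> 1)" for s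
        unfolding 2 sph_1 by (simp only: fun_upd_other[OF False[symmetric]])
      show ?thesis unfolding eq if_P[OF kj] by (rule DP) (use j False in auto)
    qed
  next
    case 3
    then have kj: "k \<le> j + 1" using j by simp
    show ?thesis
    proof (cases "j = 1")
      case True
      then have "j \<notin> {2..d}" by simp
      then have eq: "sph d (\<theta>(j := s)) k = (\<Prod>i=2..d. sin (\<theta> i)) * sin s" for s
        unfolding 3 sph_2 prod_sin_upd[OF \<open>j \<notin> {2..d}\<close>] using True by (simp only: fun_upd_same)
      show ?thesis unfolding eq if_P[OF kj] by (rule Dsin)
    next
      case False
      then have eq: "sph d (\<theta>(j := s)) k = (\<Prod>i=2..d. sin ((\<theta>(j := s)) i)) * sin (\<theta> 1)" for s
        unfolding 3 sph_2 by (simp only: fun_upd_other[OF False[symmetric]])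
      show ?thesis unfolding eq if_P[OF kj] by (rule DP) (use j False in auto)
    qed
  next
    case 4
    \<comment> \<open>Angle \<open>j\<close> enters coordinate \<open>k\<close> through its cosine,
      through one of the sines, or not at all.\<close>
    consider "j = k - 1" | "j \<ge> k" | "j < k - 1" by linarith
    then show ?thesis
    proof cases
      case 1
      then have kj: "k \<le> j + 1" and "j \<notin> {k..d}" using 4 by auto
      then have eq: "sph d (\<theta>(j := s)) k = (\<Prod>i=k..d. sin (\<theta> i)) * cos s" for s
        unfolding sph_ge3[OF 4] prod_sin_upd[OF \<open>j \<notin> {k..d}\<close>] by (simp only: 1[symmetric] fun_upd_same)
      show ?thesis unfolding eq if_P[OF kj] by (rule Dcos)
    next
      case 2
      then have kj: "k \<le> j + 1" and "k - 1 \<noteq> j" using 4 by auto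
      then have eq: "sph d (\<theta>(j := s)) k = (\<Prod>i=k..d. sin ((\<theta>(j := s)) i)) * cos (\<theta> (k - 1))" for s
        unfolding sph_ge3[OF 4] by (simp only: fun_upd_other[OF \<open>k - 1 \<noteq> j\<close>])
      show ?thesis unfolding eq if_P[OF kj] by (rule DP) (use j 2 in auto)
    next
      case 3
      then have kj: "\<not> k \<le> j + 1" and "k - 1 \<noteq> j" "j \<notin> {k..d}" by auto
      then have eq: "sph d (\<theta>(j := s)) k = sph d \<theta> k" for s
        unfolding sph_ge3[OF 4] prod_sin_upd[OF \<open>j \<notin> {k..d}\<close>] by (simp only: fun_upd_other[OF \<open>k - 1 \<noteq> j\<close>])
      show ?thesis unfolding eq if_not_P[OF kj] by simp
    qed
  qed
qed

text \<open>The tangent vector of the coordinate line of angle \<open>j\<close>. Written with the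
  quarter turn, its nonzero entries are coordinates of another point of the sphere.\<close>

definition sph_velocity :: "nat \<Rightarrow> nat \<Rightarrow> (nat \<Rightarrow> real) \<Rightarrow> nat \<Rightarrow> real" where
  "sph_velocity d j \<theta> k = (if k \<le> j + 1 then sph d (\<theta>(j := \<theta> j + pi / 2)) k else 0)"

lemma sph_curve_derivative:
  assumes "j \<in> {1..d}"
  shows "((\<lambda>t. sph d (\<theta>(j := t)) k) has_real_derivative sph_velocity d j \<theta> k) (at (\<theta> j))"
  unfolding sph_velocity_def by (rule sph_upd_derivative[OF assms])

text \<open>Only the coordinates up to \<open>j + 1\<close> contribute, and \<open>eta d j\<close>
  does not involve angle \<open>j\<close>, so the quarter turn leaves it unchanged. This length
  accounts for the weight 1/eta^2 in the theorem.\<close>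

lemma sph_velocity_dot_self:
  assumes "j \<in> {1..d}"
  shows "dot d (sph_velocity d j \<theta>) (sph_velocity d j \<theta>) = (eta d j \<theta>)\<^sup>2"
proof -
  have "dot d (sph_velocity d j \<theta>) (sph_velocity d j \<theta>) =
    (\<Sum>k=1..j+1. (sph d (\<theta>(j := \<theta> j + pi / 2)) k)\<^sup>2)"
    unfolding dot_def using assms
    by (intro sum.mono_neutral_cong_right) (auto simp: sph_velocity_def power2_eq_square)
  also have "\<dots> = (eta d j (\<theta>(j := \<theta> j + pi / 2)))\<^sup>2"
    using assms by (intro sph_square_prefix) auto
  also have "eta d j (\<theta>(j := \<theta> j + pi / 2)) = eta d j \<theta>"
    unfolding eta_def by (intro prod.cong) auto
  finally show ?thesis .
qed

text \<open>Differentiate the constant squared length of \<open>sph\<close> in angle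
  \<open>j\<close>.\<close>

lemma sph_velocity_orthogonal:
  assumes "j \<in> {1..d}"
  shows "dot d (sph_velocity d j \<theta>) (sph d \<theta>) = 0"
proof -
  have "((\<lambda>t. dot d (sph d (\<theta>(j := t))) (sph d (\<theta>(j := t)))) has_real_derivative
    (\<Sum>k=1..d+1. sph_velocity d j \<theta> k * sph d (\<theta>(j := \<theta> j)) k + sph_velocity d j \<theta> k * sph d (\<theta>(j := \<theta> j)) k)) (at (\<theta> j))"
    unfolding dot_def by (intro DERIV_sum DERIV_mult sph_curve_derivative[OF assms])
  moreover have "(\<lambda>t. dot d (sph d (\<theta>(j := t))) (sph d (\<theta>(j := t)))) = (\<lambda>t. 1)"
    using assms by (intro ext sph_dot_self) auto
  ultimately have "((\<lambda>t. 1) has_real_derivative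
    (\<Sum>k=1..d+1. sph_velocity d j \<theta> k * sph d \<theta> k + sph_velocity d j \<theta> k * sph d \<theta> k)) (at (\<theta> j))"
    by (simp only: fun_upd_triv)
  from DERIV_unique[OF this DERIV_const]
  have "(\<Sum>k=1..d+1. sph_velocity d j \<theta> k * sph d \<theta> k + sph_velocity d j \<theta> k * sph d \<theta> k) = 0" .
  then show ?thesis unfolding dot_def sum.distrib by linarith
qed

lemma sph_cong:
  assumes "1 \<le> d" "\<And>i. i \<in> {1..d} \<Longrightarrow> \<theta> i = \<theta>' i"
  shows "sph d \<theta> = sph d \<theta>'"
proof
  fix k
  have "(\<Prod>i=a..d. sin (\<theta> i)) = (\<Prod>i=a..d. sin (\<theta>' i))" if "1 \<le> a" for a
    using that assms by (intro prod.cong) auto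
  moreover have "\<theta> (k - 1) = \<theta>' (k - 1)" if "3 \<le> k" "k \<le> d + 1"
    using that by (intro assms(2)) auto
  ultimately show "sph d \<theta> k = sph d \<theta>' k"
    using assms(1) assms(2)[of 1] unfolding sph_def by simp
qed

text \<open>The angles of \<open>\<theta>\<close> are replaced by those of \<open>\<theta>'\<close>
  one at a time; \<open>m\<close> counts the angles already replaced.\<close>

lemma sph_invariant_const:
  assumes "1 \<le> d" "\<And>\<theta> j t. j \<in> {1..d} \<Longrightarrow> f (sph d (\<theta>(j := t))) = f (sph d \<theta>)"
  shows "f (sph d \<theta>) = f (sph d \<theta>')"
proof -
  have "f (sph d (\<lambda>i. if i \<in> {1..m} then \<theta>' i else \<theta> i)) = f (sph d \<theta>)" if "m \<le> d" for m
    using that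
  proof (induction m)
    case (Suc m)
    have "(\<lambda>i. if i \<in> {1..Suc m} then \<theta>' i else \<theta> i) =
      (\<lambda>i. if i \<in> {1..m} then \<theta>' i else \<theta> i)(Suc m := \<theta>' (Suc m))" by auto
    then show ?case using Suc assms(2) by (simp del: fun_upd_apply)
  qed simp
  from this[of d] show ?thesis
    using sph_cong[OF assms(1), of "\<lambda>i. if i \<in> {1..d} then \<theta>' i else \<theta> i" \<theta>'] by simp
qed

section \<open>Linearity of the derivatives and squares of rotations\<close>

lemma dir_lincomb:
  assumes "\<And>m. m \<in> M \<Longrightarrow> hom_poly d l (F m)"
  shows "dir d v (\<lambda>x. \<Sum>m\<in>M. c m * F m x) x = (\<Sum>m\<in>M. c m * dir d v (F m) x)"
proof -
  have "partial i (\<lambda>x. \<Sum>m\<in>M. c m * F m x) x = (\<Sum>m\<in>M. c m * partial i (F m) x)" for i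
    by (subst partial_sum[OF hom_poly_cmult[OF assms]]) (auto intro!: sum.cong partial_cmult[OF assms])
  then have "dir d v (\<lambda>x. \<Sum>m\<in>M. c m * F m x) x =
    (\<Sum>i=1..d+1. \<Sum>m\<in>M. c m * (of_real (v i) * partial i (F m) x))"
    unfolding dir_def by (simp only: sum_distrib_left mult.left_commute)
  then show ?thesis unfolding dir_def sum_distrib_left by (subst sum.swap)
qed

text \<open>Like \<open>dir_lincomb\<close>, this is the linearity that \<open>rot_pairing\<close>
  asks of its functionals.\<close>

lemma rot_lincomb:
  assumes "\<And>m. m \<in> M \<Longrightarrow> hom_poly d l (F m)"
  shows "rot d v w (\<lambda>x. \<Sum>m\<in>M. c m * F m x) x = (\<Sum>m\<in>M. c m * rot d v w (F m) x)"
proof -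
  have "dir d u (\<lambda>x. \<Sum>m\<in>M. c m * F m x) x = (\<Sum>m\<in>M. c m * dir d u (F m) x)" for u
    by (rule dir_lincomb[OF assms])
  then show ?thesis
    unfolding rot_def by (simp add: sum_distrib_left sum_subtractf algebra_simps)
qed

text \<open>Leibniz rule: differentiating the coefficient \<open>dot d v x\<close> along
  \<open>u\<close> gives \<open>dot d u v\<close>. When \<open>v\<close> and \<open>w\<close> are
  orthogonal to \<open>x\<close>, the second-order terms drop out.\<close>

lemma dir_rot:
  assumes "hom_poly d l F"
  shows "dir d u (rot d v w F) x =
    of_real (dot d u v) * dir d w F x + of_real (dot d v x) * dir d w (dir d u F) x -
    of_real (dot d u w) * dir d v F x - of_real (dot d w x) * dir d v (dir d u F) x"
proof -
  have 1: "(\<Sum>i=1..d+1. of_real (u i) * dir d w (partial i F) x) = dir d w (dir d u F) x" for w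
    unfolding dir_commute[OF assms, of w] unfolding dir_def[of d u]
    by (simp only: partial_dir[OF assms])
  have "dir d u (rot d v w F) x = (\<Sum>i=1..d+1.
     of_real (u i * v i) * dir d w F x + of_real (dot d v x) * (of_real (u i) * dir d w (partial i F) x) -
     of_real (u i * w i) * dir d v F x - of_real (dot d w x) * (of_real (u i) * dir d v (partial i F) x))"
    unfolding dir_def[of d u]
    by (intro sum.cong refl) (simp only: partial_rot[OF assms], simp add: algebra_simps)
  also have "\<dots> = of_real (dot d u v) * dir d w F x + of_real (dot d v x) * dir d w (dir d u F) x -
    of_real (dot d u w) * dir d v F x - of_real (dot d w x) * dir d v (dir d u F) x"
    unfolding sum.distrib sum_subtractf sum_distrib_left[symmetric] sum_distrib_right[symmetric] 1
    by (simp only: dot_def of_real_sum)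
  finally show ?thesis .
qed

lemma dir_euler: "hom_poly d l F \<Longrightarrow> dir d x F x = of_nat l * F x"
  unfolding dir_def by (rule hom_poly_euler)

definition axis_vec :: "nat \<Rightarrow> nat \<Rightarrow> real" where
  "axis_vec i k = (if k = i then 1 else 0)"

lemma dot_commute: "dot d v w = dot d w v"
  by (simp add: dot_def mult.commute)

lemma dot_axis:
  assumes "i \<in> {1..d+1}"
  shows "dot d (axis_vec i) v = v i"
proof -
  have "dot d (axis_vec i) v = (\<Sum>k=1..d+1. if k = i then v k else 0)"
    unfolding dot_def axis_vec_def by (intro sum.cong) auto
  then show ?thesis using assms by (simp del: sum.cl_ivl_Suc)
qed

lemma dir_axis:
  assumes "i \<in> {1..d+1}"
  shows "dir d (axis_vec i) F x = partial i F x"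
proof -
  have "dir d (axis_vec i) F x = (\<Sum>k=1..d+1. if k = i then partial k F x else 0)"
    unfolding dir_def axis_vec_def by (intro sum.cong) auto
  then show ?thesis using assms by (simp del: sum.cl_ivl_Suc)
qed

text \<open>Here \<open>x\<close> is both the point of evaluation and a fixed vector defining the
  rotation. In the latter role it is not differentiated, and \<open>dir d x F\<close> has constant
  coefficients.\<close>

lemma rot_axis_twice:
  assumes F: "hom_poly d l F" and i: "i \<in> {1..d+1}" and x: "dot d x x = 1"
  shows "rot d x (axis_vec i) (rot d x (axis_vec i) F) x =
    partial i (partial i F) x - 2 * (of_real (x i) * partial i (dir d x F) x)
    - (1 - (of_real (x i))\<^sup>2) * dir d x F x + (of_real (x i))\<^sup>2 * dir d x (dir d x F) x"
proof -
  let ?e = "axis_vec i"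
  have ax: "dot d ?e x = x i" "dot d x ?e = x i" "dot d ?e ?e = 1"
    using dot_axis[OF i] dot_commute[of d x] by (simp_all add: axis_vec_def)
  have eq: "dir d ?e F = partial i F" by (rule ext) (rule dir_axis[OF i])
  show ?thesis
    unfolding rot_def[of d x ?e "rot d x ?e F"] dir_rot[OF F] ax x
    unfolding dir_commute[OF F, of x ?e] unfolding dir_axis[OF i] eq
    by (simp add: algebra_simps power2_eq_square)
qed

text \<open>The factor is the eigenvalue of the spherical Laplacian. The flat Laplacian vanishes,
  and what remains are first and second derivatives along \<open>x\<close>, which Euler's identity
  evaluates.\<close>

lemma sum_rot_axis_twice:
  assumes P: "P \<in> sph_harm d l" and x: "dot d x x = 1"
  shows "(\<Sum>i=1..d+1. rot d x (axis_vec i) (rot d x (axis_vec i) P) x) =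
    - (of_nat l * (of_nat l + of_nat d - 1)) * P x"
proof -
  have F: "hom_poly d l P" and lap: "laplacian d P x = 0" using P by (auto simp: sph_harm_def)
  have sq: "(\<Sum>i=1..d+1. (complex_of_real (x i))\<^sup>2) = 1"
    using x by (simp add: dot_def power2_eq_square del: sum.cl_ivl_Suc flip: of_real_mult of_real_sum)
  have "(\<Sum>i=1..d+1. rot d x (axis_vec i) (rot d x (axis_vec i) P) x) =
    (\<Sum>i=1..d+1. partial i (partial i P) x - 2 * (of_real (x i) * partial i (dir d x P) x)
    - (1 - (of_real (x i))\<^sup>2) * dir d x P x + (of_real (x i))\<^sup>2 * dir d x (dir d x P) x)"
    by (intro sum.cong refl rot_axis_twice[OF F _ x])
  also have "\<dots> = laplacian d P x - 2 * (\<Sum>i=1..d+1. of_real (x i) * partial i (dir d x P) x)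
    - (of_nat (d + 1) * dir d x P x - (\<Sum>i=1..d+1. (complex_of_real (x i))\<^sup>2) * dir d x P x)
    + (\<Sum>i=1..d+1. (complex_of_real (x i))\<^sup>2) * dir d x (dir d x P) x"
    unfolding laplacian_def
    by (simp add: sum.distrib sum_subtractf sum_distrib_left sum_distrib_right left_diff_distrib del: sum.cl_ivl_Suc)
  also have "\<dots> = - dir d x (dir d x P) x - of_nat d * dir d x P x"
    unfolding sq lap dir_def[of d x "dir d x P", symmetric] by (simp add: algebra_simps)
  \<comment> \<open>The inner direction is a constant vector, so \<open>dir d x P\<close> has degree
    \<open>l - 1\<close> and the factor is \<open>l - 1\<close>, not \<open>l\<close>.\<close>
  also have "dir d x (dir d x P) x = of_nat (l - 1) * dir d x P x"
    by (rule dir_euler[OF hom_poly_dir[OF F]])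
  also have "dir d x P x = of_nat l * P x" by (rule dir_euler[OF F])
  also have "- (of_nat (l - 1) * (of_nat l * P x)) - of_nat d * (of_nat l * P x) =
    - (of_nat l * (of_nat l + of_nat d - 1)) * P x"
    by (cases l) (simp_all add: algebra_simps)
  finally show ?thesis .
qed

section \<open>Gegenbauer polynomials at 1\<close>

lemma gegenbauer_one: "gegenbauer n a 1 = pochhammer (2 * a) n / fact n"
proof (induction n a "1::real" rule: gegenbauer.induct)
  case (3 n a)
  define p where "p = pochhammer (2 * a) n"
  define f :: real where "f = fact n"
  define k where "k = real n + 1"
  have pos: "f > 0" "k > 0" by (simp_all add: f_def k_def)
  have n: "real n = k - 1" by (simp add: k_def)
  have 1: "gegenbauer n a 1 = p / f" using 3 by (simp add: p_def f_def)
  have 2: "gegenbauer (Suc n) a 1 = p * (2 * a + k - 1) / (k * f)"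
    using 3 by (simp add: p_def f_def k_def pochhammer_Suc add_ac)
  \<comment> \<open>The numerator has the common factor \<open>2 * a + k - 1\<close>; what is left,
    2 (k + a) - k = 2 a + k, is the next factor of the rising factorial.\<close>
  have "gegenbauer (Suc (Suc n)) a 1 =
    (2 * (k + a) * (p * (2 * a + k - 1) / (k * f)) - (k - 1 + 2 * a) * (p / f)) / (k + 1)"
    by (simp only: gegenbauer.simps 1 2 n) simp
  also have "\<dots> = p * (2 * a + k - 1) * (2 * a + k) / ((k + 1) * (k * f))"
    using pos by (simp add: divide_simps) (simp add: algebra_simps)
  also have "\<dots> = pochhammer (2 * a) (Suc (Suc n)) / fact (Suc (Suc n))"
    by (simp add: p_def f_def k_def pochhammer_Suc add_ac)
  finally show ?case .
qed simp_all

text \<open>The rising factorial of d - 1 with l + 1 factors is split in two ways: after its first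
  two factors, and before its last one. This converts the eigenvalue l (l + d - 1) into the constant
  of the theorem.\<close>

lemma gegenbauer_one_ratio:
  assumes "1 \<le> l"
  shows "real d * (real d - 1) * gegenbauer (l - 1) ((real d + 1) / 2) 1 =
    real l * (real l + real d - 1) * gegenbauer l ((real d - 1) / 2) 1"
proof -
  obtain n where l: "l = Suc n" using assms by (cases l) auto
  have "pochhammer (real d - 1) (Suc (Suc n)) = (real d - 1) * (real d * pochhammer (real d + 1) n)"
    unfolding pochhammer_rec by simp
  moreover have "pochhammer (real d - 1) (Suc (Suc n)) = pochhammer (real d - 1) (Suc n) * (real d + real n)"
    by (subst pochhammer_Suc) simp
  ultimately have "(real d - 1) * (real d * pochhammer (real d + 1) n) = pochhammer (real d - 1) (Suc n) * (real d + real n)"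
    by simp
  moreover have "gegenbauer (l - 1) ((real d + 1) / 2) 1 = pochhammer (real d + 1) n / fact n"
    unfolding l gegenbauer_one by (simp del: distrib_left_numeral)
  moreover have "gegenbauer l ((real d - 1) / 2) 1 = pochhammer (real d - 1) (Suc n) / (real l * fact n)"
    unfolding l gegenbauer_one by (simp del: distrib_left_numeral right_diff_distrib_numeral pochhammer_Suc)
  moreover have "real l > 0" "real l + real d - 1 = real d + real n" by (simp_all add: l)
  ultimately show ?thesis by (simp add: mult_ac)
qed

section \<open>Orthonormal bases of spherical harmonics\<close>

lemma sph_inner_cnj: "sph_inner d f g = cnj (sph_inner d g f)"
proof -
  have "indicator (angle_dom d) \<theta> *\<^sub>R (f (sph d \<theta>) * cnj (g (sph d \<theta>)) * of_real (sph_weight d \<theta>)) =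
    cnj (indicator (angle_dom d) \<theta> *\<^sub>R (g (sph d \<theta>) * cnj (f (sph d \<theta>)) * of_real (sph_weight d \<theta>)))" for \<theta>
    by (simp add: mult_ac)
  then show ?thesis
    unfolding sph_inner_def set_lebesgue_integral_def by (simp only: Bochner_Integration.integral_cnj)
qed

lemma sph_inner_lincomb:
  assumes "\<And>m. m \<in> M \<Longrightarrow> hom_poly d l (F m)" "hom_poly d l Q" "1 \<le> d"
  shows "sph_inner d (\<lambda>x. \<Sum>m\<in>M. c m * F m x) Q = (\<Sum>m\<in>M. c m * sph_inner d (F m) Q)"
proof -
  have "sph_inner d (\<lambda>x. \<Sum>m\<in>M. c m * F m x) Q =
    sph_integral d (\<lambda>x. \<Sum>m\<in>M. c m * (F m x * cnj (Q x)))"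
    unfolding sph_inner_eq by (simp only: sum_distrib_right mult.assoc)
  also have "\<dots> = (\<Sum>m\<in>M. sph_integral d (\<lambda>x. c m * (F m x * cnj (Q x))))"
    by (rule sph_integral_sum[OF hom_poly_cmult[OF hom_poly_mult[OF assms(1) hom_poly_cnj[OF assms(2)]]] assms(3)])
  finally show ?thesis unfolding sph_inner_eq by (simp only: sph_integral_cmult)
qed

text \<open>The length \<open>N\<close> of the basis is left open here; the theorem instantiates it
  with \<open>Ndim d l\<close>.\<close>

locale harmonic_onb =
  fixes d l N :: nat and Y :: "nat \<Rightarrow> (nat \<Rightarrow> real) \<Rightarrow> complex"
  assumes d: "1 \<le> d"
    and harm: "\<And>m. m \<in> {1..N} \<Longrightarrow> Y m \<in> sph_harm d l"
    and orthonormal: "\<And>m n. m \<in> {1..N} \<Longrightarrow> n \<in> {1..N} \<Longrightarrow>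
      sph_inner d (Y m) (Y n) = (if m = n then 1 else 0)"
    and spanning: "\<And>P. P \<in> sph_harm d l \<Longrightarrow> \<exists>c. \<forall>x. P x = (\<Sum>m=1..N. c m * Y m x)"
begin

lemma hom: "m \<in> {1..N} \<Longrightarrow> hom_poly d l (Y m)"
  using harm by (simp add: sph_harm_def)

text \<open>The coefficients exist because \<open>rot\<close> preserves the harmonic polynomials. By
  orthonormality they are the inner products of \<open>rot d v w (Y m)\<close> with
  \<open>Y n\<close>, so skewness of \<open>rot\<close> makes the matrix skew-Hermitian.\<close>

lemma rot_matrix:
  obtains a where "\<And>m. m \<in> {1..N} \<Longrightarrow> rot d v w (Y m) = (\<lambda>x. \<Sum>n=1..N. a m n * Y n x)"
    and "\<And>m n. m \<in> {1..N} \<Longrightarrow> n \<in> {1..N} \<Longrightarrow> a m n = - cnj (a n m)"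
proof -
  have "\<forall>m\<in>{1..N}. \<exists>c. rot d v w (Y m) = (\<lambda>x. \<Sum>n=1..N. c n * Y n x)"
    using spanning[OF sph_harm_rot[OF harm]] by (auto simp: fun_eq_iff)
  then obtain a where a: "\<And>m. m \<in> {1..N} \<Longrightarrow> rot d v w (Y m) = (\<lambda>x. \<Sum>n=1..N. a m n * Y n x)"
    by metis
  have coeff: "sph_inner d (rot d v w (Y m)) (Y n) = a m n" if "m \<in> {1..N}" "n \<in> {1..N}" for m n
  proof -
    have "sph_inner d (rot d v w (Y m)) (Y n) = (\<Sum>k=1..N. a m k * sph_inner d (Y k) (Y n))"
      unfolding a[OF that(1)] by (rule sph_inner_lincomb[OF hom hom[OF that(2)] d])
    also have "\<dots> = (\<Sum>k=1..N. if k = n then a m k else 0)"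
      using that by (intro sum.cong refl) (simp add: orthonormal)
    also have "\<dots> = a m n" using that by simp
    finally show ?thesis .
  qed
  have "a m n = - cnj (a n m)" if m: "m \<in> {1..N}" and n: "n \<in> {1..N}" for m n
    using sph_inner_rot[OF hom[OF m] hom[OF n] d, of v w]
      sph_inner_cnj[of d "Y m" "rot d v w (Y n)"] coeff[OF m n] coeff[OF n m] by simp
  with a show thesis by (rule that)
qed

text \<open>Expanding the rotated functions in the basis and exchanging the two sums moves the
  matrix from one functional to the other; skew-Hermitian symmetry contributes the sign and the
  conjugate.\<close>

lemma rot_pairing:
  assumes \<phi>: "\<And>c. \<phi> (\<lambda>x. \<Sum>n=1..N. c n * Y n x) = (\<Sum>n=1..N. c n * \<phi> (Y n))"
    and \<psi>: "\<And>c. \<psi> (\<lambda>x. \<Sum>n=1..N. c n * Y n x) = (\<Sum>n=1..N. c n * \<psi> (Y n))"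
  shows "(\<Sum>m=1..N. \<phi> (rot d v w (Y m)) * cnj (\<psi> (Y m))) =
    - (\<Sum>m=1..N. \<phi> (Y m) * cnj (\<psi> (rot d v w (Y m))))"
proof -
  obtain a where a: "\<And>m. m \<in> {1..N} \<Longrightarrow> rot d v w (Y m) = (\<lambda>x. \<Sum>n=1..N. a m n * Y n x)"
    and skew: "\<And>m n. m \<in> {1..N} \<Longrightarrow> n \<in> {1..N} \<Longrightarrow> a m n = - cnj (a n m)"
    using rot_matrix[where v = v and w = w] by blast
  have "(\<Sum>m=1..N. \<phi> (rot d v w (Y m)) * cnj (\<psi> (Y m))) =
    (\<Sum>m=1..N. \<Sum>n=1..N. a m n * \<phi> (Y n) * cnj (\<psi> (Y m)))"
    by (intro sum.cong refl) (simp only: a \<phi> sum_distrib_right)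
  also have "\<dots> = (\<Sum>n=1..N. \<Sum>m=1..N. - cnj (a n m) * \<phi> (Y n) * cnj (\<psi> (Y m)))"
    by (subst sum.swap) (intro sum.cong refl, simp only: skew[symmetric])
  also have "\<dots> = - (\<Sum>n=1..N. \<phi> (Y n) * cnj (\<Sum>m=1..N. a n m * \<psi> (Y m)))"
    by (simp add: sum_distrib_left sum_negf mult_ac)
  also have "\<dots> = - (\<Sum>m=1..N. \<phi> (Y m) * cnj (\<psi> (rot d v w (Y m))))"
    by (intro arg_cong[of _ _ uminus] sum.cong refl) (simp only: a \<psi>)
  finally show ?thesis .
qed

section \<open>Density and directional energy of the basis\<close>

definition energy :: "(nat \<Rightarrow> real) \<Rightarrow> (nat \<Rightarrow> real) \<Rightarrow> real" where
  "energy x v = (\<Sum>m=1..N. (cmod (dir d v (Y m) x))\<^sup>2)"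

lemma of_real_energy: "of_real (energy x v) = (\<Sum>m=1..N. dir d v (Y m) x * cnj (dir d v (Y m) x))"
  by (simp only: energy_def of_real_sum complex_norm_square)

definition density :: "(nat \<Rightarrow> real) \<Rightarrow> real" where
  "density x = (\<Sum>m=1..N. (cmod (Y m x))\<^sup>2)"

lemma of_real_density: "of_real (density x) = (\<Sum>m=1..N. Y m x * cnj (Y m x))"
  by (simp only: density_def of_real_sum complex_norm_square)

text \<open>Pair the derivatives along \<open>v\<close> and \<open>w\<close> for the rotation in
  their own plane; the terms with \<open>dot d v w\<close> agree on both sides and cancel. Without
  division the identity also covers zero vectors, which occur below as projected axes.\<close>

lemma energy_tangent_isotropic:
  assumes "dot d v x = 0" "dot d w x = 0"
  shows "dot d v v * energy x w = dot d w w * energy x v"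
proof -
  have "(\<Sum>m=1..N. dir d v (rot d v w (Y m)) x * cnj (dir d w (Y m) x)) =
    - (\<Sum>m=1..N. dir d v (Y m) x * cnj (dir d w (rot d v w (Y m)) x))"
    by (rule rot_pairing[of "\<lambda>F. dir d v F x" "\<lambda>F. dir d w F x"]) (rule dir_lincomb[OF hom], assumption)+
  moreover have "dir d v (rot d v w (Y m)) x =
      of_real (dot d v v) * dir d w (Y m) x - of_real (dot d v w) * dir d v (Y m) x"
    "dir d w (rot d v w (Y m)) x =
      of_real (dot d v w) * dir d w (Y m) x - of_real (dot d w w) * dir d v (Y m) x"
    if "m \<in> {1..N}" for m
    using assms by (simp_all add: dir_rot[OF hom[OF that]] dot_commute[of d w v])
  ultimately have "(\<Sum>m=1..N. (of_real (dot d v v) * dir d w (Y m) x - of_real (dot d v w) * dir d v (Y m) x) * cnj (dir d w (Y m) x)) =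
    - (\<Sum>m=1..N. dir d v (Y m) x * cnj (of_real (dot d v w) * dir d w (Y m) x - of_real (dot d w w) * dir d v (Y m) x))"
    by (simp only: cong: sum.cong)
  then have "of_real (dot d v v * energy x w) = (of_real (dot d w w * energy x v) :: complex)"
    unfolding of_real_mult of_real_energy
    by (simp add: sum_distrib_left sum_subtractf algebra_simps)
  then show ?thesis by (simp only: of_real_eq_iff)
qed

text \<open>The vector \<open>axis_vec i - x i * x\<close> is the tangential projection of an axis,
  and the derivative along it at \<open>x\<close> is a rotation evaluated there. Pairing with
  evaluation at \<open>x\<close> turns the sum of squares into minus the twice applied rotation,
  which \<open>sum_rot_axis_twice\<close> computes.\<close>

lemma energy_axis_sum:
  assumes x: "dot d x x = 1"
  shows "(\<Sum>i=1..d+1. energy x (\<lambda>k. axis_vec i k - x i * x k)) =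
    real l * (real l + real d - 1) * density x"
proof -
  have rot_dir: "dir d (\<lambda>k. axis_vec i k - x i * x k) F x = rot d x (axis_vec i) F x"
    if "i \<in> {1..d+1}" for i F
  proof -
    have "dir d (\<lambda>k. axis_vec i k - x i * x k) F x = dir d (axis_vec i) F x - of_real (x i) * dir d x F x"
      by (simp add: dir_def sum_subtractf sum_distrib_left left_diff_distrib mult.assoc del: sum.cl_ivl_Suc)
    then show ?thesis by (simp add: rot_def x dot_axis[OF that])
  qed
  have "(\<Sum>m=1..N. rot d x (axis_vec i) (rot d x (axis_vec i) (Y m)) x * cnj (Y m x)) =
    - (\<Sum>m=1..N. rot d x (axis_vec i) (Y m) x * cnj (rot d x (axis_vec i) (Y m) x))" for i
    by (rule rot_pairing[of "\<lambda>F. rot d x (axis_vec i) F x" "\<lambda>F. F x"]) (rule rot_lincomb[OF hom], assumption, rule refl)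
  then have "complex_of_real (energy x (\<lambda>k. axis_vec i k - x i * x k)) =
    - (\<Sum>m=1..N. rot d x (axis_vec i) (rot d x (axis_vec i) (Y m)) x * cnj (Y m x))"
    if "i \<in> {1..d+1}" for i
    unfolding of_real_energy rot_dir[OF that] by simp
  then have "complex_of_real (\<Sum>i=1..d+1. energy x (\<lambda>k. axis_vec i k - x i * x k)) =
    - (\<Sum>i=1..d+1. \<Sum>m=1..N. rot d x (axis_vec i) (rot d x (axis_vec i) (Y m)) x * cnj (Y m x))"
    by (simp add: sum_negf del: sum.cl_ivl_Suc)
  also have "\<dots> = - (\<Sum>m=1..N. (\<Sum>i=1..d+1. rot d x (axis_vec i) (rot d x (axis_vec i) (Y m)) x) * cnj (Y m x))"
    unfolding sum_distrib_right by (subst sum.swap) (rule refl)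
  also have "\<dots> = - (\<Sum>m=1..N. (- (of_nat l * (of_nat l + of_nat d - 1)) * Y m x) * cnj (Y m x))"
    by (intro arg_cong[of _ _ uminus] sum.cong refl) (simp only: sum_rot_axis_twice[OF harm x])
  also have "\<dots> = of_nat l * (of_nat l + of_nat d - 1) * of_real (density x)"
    unfolding of_real_density by (simp add: sum_distrib_left sum_negf mult.assoc)
  also have "\<dots> = of_real (real l * (real l + real d - 1) * density x)"
    by simp
  finally show ?thesis by (simp only: of_real_eq_iff)
qed

text \<open>At the unit vector \<open>x\<close> the rotation in the plane of \<open>x\<close> and
  \<open>v\<close> is the derivative along \<open>v\<close>; both functionals are evaluation at
  \<open>x\<close>.\<close>

lemma density_tangent_derivative:
  assumes x: "dot d x x = 1" and v: "dot d v x = 0"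
  shows "(\<Sum>m=1..N. Y m x * cnj (dir d v (Y m) x) + dir d v (Y m) x * cnj (Y m x)) = 0"
proof -
  have "rot d x v F x = dir d v F x" for F using x v by (simp add: rot_def)
  then show ?thesis
    using rot_pairing[of "\<lambda>F. F x" "\<lambda>F. F x" x v] by (simp add: sum.distrib)
qed

text \<open>The velocity of each coordinate line is tangent, so the density has derivative zero in
  every single angle.\<close>

lemma density_sph_const: "density (sph d \<theta>) = density (sph d \<theta>')"
proof (rule sph_invariant_const[OF d])
  fix \<theta> j t assume j: "j \<in> {1..d}"
  let ?f = "\<lambda>t. \<Sum>m=1..N. Y m (sph d (\<theta>(j := t))) * cnj (Y m (sph d (\<theta>(j := t))))"
  have "(?f has_vector_derivative 0) (at s)" for s
  proof -
    let ?\<theta> = "\<theta>(j := s)"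
    have D: "((\<lambda>t. Y m (sph d (\<theta>(j := t)))) has_vector_derivative dir d (sph_velocity d j ?\<theta>) (Y m) (sph d ?\<theta>)) (at s)"
      if "m \<in> {1..N}" for m
      using hom_poly_curve_derivative[OF hom[OF that] sph_curve_derivative[OF j, of ?\<theta>]]
      by (simp add: dir_def del: sum.cl_ivl_Suc)
    have "(?f has_vector_derivative (\<Sum>m=1..N.
       Y m (sph d ?\<theta>) * cnj (dir d (sph_velocity d j ?\<theta>) (Y m) (sph d ?\<theta>)) +
       dir d (sph_velocity d j ?\<theta>) (Y m) (sph d ?\<theta>) * cnj (Y m (sph d ?\<theta>)))) (at s)"
      by (intro has_vector_derivative_sum has_vector_derivative_mult has_vector_derivative_cnj D)
    then show ?thesis
      unfolding density_tangent_derivative[OF sph_dot_self[OF d] sph_velocity_orthogonal[OF j]] .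
  qed
  then obtain c where c: "\<And>t. ?f t = c"
    using has_vector_derivative_zero_constant[of UNIV ?f] by auto
  have "?f t = ?f (\<theta> j)" unfolding c ..
  then show "density (sph d (\<theta>(j := t))) = density (sph d \<theta>)"
    unfolding fun_upd_triv of_real_density[symmetric] of_real_eq_iff .
qed

text \<open>Integrate the density: each basis element contributes 1, and the density is
  constant.\<close>

lemma density_sphere_area: "density (sph d \<theta>) * sphere_area d = real N"
proof -
  define A where "A = density (sph d \<theta>)"
  have A: "density (sph d \<theta>') = A" for \<theta>'
    unfolding A_def by (rule density_sph_const)
  have "of_nat N = (\<Sum>m=1..N. sph_inner d (Y m) (Y m))"
    by (simp add: orthonormal)
  also have "\<dots> = sph_integral d (\<lambda>x. of_real (density x))"
    unfolding of_real_density sph_inner_eq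
    by (rule sph_integral_sum[OF hom_poly_mult[OF hom hom_poly_cnj[OF hom]] d, symmetric])
  also have "\<dots> = of_real A * of_real (sphere_area d)"
    by (simp add: sph_integral_def A sphere_area_def set_integral_complex_of_real)
  finally have "complex_of_real (real N) = of_real (A * sphere_area d)" by simp
  then show ?thesis unfolding of_real_eq_iff by (simp add: A)
qed

text \<open>Isotropy compares the velocity with every projected axis \<open>?w i\<close>, of squared
  length 1 - x_i^2. These squared lengths add up to (d + 1) - 1 = d, the dimension of the tangent
  space.\<close>

lemma energy_velocity:
  assumes j: "j \<in> {1..d}"
  shows "real d * energy (sph d \<theta>) (sph_velocity d j \<theta>) =
    (eta d j \<theta>)\<^sup>2 * (real l * (real l + real d - 1) * density (sph d \<theta>))"
proof -
  let ?x = "sph d \<theta>" and ?v = "sph_velocity d j \<theta>"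
  let ?w = "\<lambda>i k. axis_vec i k - ?x i * ?x k"
  have x: "dot d ?x ?x = 1" by (rule sph_dot_self[OF d])
  have dotw: "dot d (?w i) u = u i - ?x i * dot d ?x u" if "i \<in> {1..d+1}" for i u
    using dot_axis[OF that, of u]
    by (simp add: dot_def left_diff_distrib sum_subtractf sum_distrib_left mult.assoc del: sum.cl_ivl_Suc)
  have w: "dot d (?w i) ?x = 0" "dot d (?w i) (?w i) = 1 - ?x i * ?x i" if "i \<in> {1..d+1}" for i
  proof -
    show "dot d (?w i) ?x = 0" by (simp add: dotw[OF that] x)
    then have "dot d ?x (?w i) = 0" by (simp only: dot_commute)
    with dotw[OF that, of "?w i"] show "dot d (?w i) (?w i) = 1 - ?x i * ?x i"
      by (simp only:) (simp add: axis_vec_def)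
  qed
  have "(eta d j \<theta>)\<^sup>2 * energy ?x (?w i) = (1 - ?x i * ?x i) * energy ?x ?v" if "i \<in> {1..d+1}" for i
    using energy_tangent_isotropic[OF sph_velocity_orthogonal[OF j] w(1)[OF that]]
    by (simp only: sph_velocity_dot_self[OF j] w(2)[OF that])
  then have "(eta d j \<theta>)\<^sup>2 * (\<Sum>i=1..d+1. energy ?x (?w i)) = (\<Sum>i=1..d+1. 1 - ?x i * ?x i) * energy ?x ?v"
    unfolding sum_distrib_left sum_distrib_right by (intro sum.cong refl)
  moreover have "(\<Sum>i=1..d+1. 1 - ?x i * ?x i) = real d"
    using x by (simp add: dot_def sum_subtractf del: sum.cl_ivl_Suc)
  ultimately show ?thesis unfolding energy_axis_sum[OF x] by simp
qed

end

theorem theorem2p1: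
  fixes d l :: nat and Y :: "nat \<Rightarrow> (nat \<Rightarrow> real) \<Rightarrow> complex"
  assumes "d \<ge> 3"
    and harm: "\<forall>m\<in>{1..Ndim d l}. Y m \<in> sph_harm d l"
    and orthonormal: "\<forall>m\<in>{1..Ndim d l}. \<forall>m'\<in>{1..Ndim d l}.
            sph_inner d (Y m) (Y m') = (if m = m' then 1 else 0)"
    and spanning: "\<forall>P\<in>sph_harm d l. \<exists>c. \<forall>x. P x = (\<Sum>m=1..Ndim d l. c m * Y m x)"
  shows "\<forall>j\<in>{1..d}. \<forall>\<theta>. \<theta> 1 \<in> {0..<2*pi} \<and> (\<forall>i\<in>{2..d}. \<theta> i \<in> {0<..<pi}) \<longrightarrow>
     (\<Sum>m=1..Ndim d l. (1 / (eta d j \<theta>)\<^sup>2) *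
         (cmod (vector_derivative (\<lambda>t. Y m (sph d (\<theta>(j := t)))) (at (\<theta> j))))\<^sup>2)
     = (real d - 1) * Kconst d l * (if l = 0 then 0 else gegenbauer (l - 1) ((real d + 1) / 2) 1)"
proof (intro ballI allI impI)
  fix j \<theta> assume j: "j \<in> {1..d}" and "\<theta> 1 \<in> {0..<2*pi} \<and> (\<forall>i\<in>{2..d}. \<theta> i \<in> {0<..<pi})"
  \<comment> \<open>\<open>eta d j\<close> involves only angles with index at least 2, which lie
    strictly between 0 and \<open>pi\<close>.\<close>
  then have "sin (\<theta> i) \<noteq> 0" if "i \<in> {j+1..d}" for i
    using that sin_gt_zero[of "\<theta> i"] by auto
  then have eta: "eta d j \<theta> \<noteq> 0" by (simp add: eta_def)
  interpret harmonic_onb d l "Ndim d l" Y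
    using assms by unfold_locales auto
  define E where "E = energy (sph d \<theta>) (sph_velocity d j \<theta>)"
  define C where "C = gegenbauer l ((real d - 1) / 2) 1"
  define C' where "C' = (if l = 0 then 0 else gegenbauer (l - 1) ((real d + 1) / 2) 1)"
  have "vector_derivative (\<lambda>t. Y m (sph d (\<theta>(j := t)))) (at (\<theta> j)) =
      dir d (sph_velocity d j \<theta>) (Y m) (sph d \<theta>)" if "m \<in> {1..Ndim d l}" for m
    using hom_poly_curve_derivative[OF hom[OF that] sph_curve_derivative[OF j, of \<theta>]]
    by (intro vector_derivative_at) (simp add: dir_def del: sum.cl_ivl_Suc)
  then have lhs: "(\<Sum>m=1..Ndim d l. (1 / (eta d j \<theta>)\<^sup>2) *
         (cmod (vector_derivative (\<lambda>t. Y m (sph d (\<theta>(j := t)))) (at (\<theta> j))))\<^sup>2) = E / (eta d j \<theta>)\<^sup>2"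
    by (simp add: E_def energy_def sum_divide_distrib)
  have E: "real d * (E / (eta d j \<theta>)\<^sup>2) = real l * (real l + real d - 1) * density (sph d \<theta>)"
    using energy_velocity[OF j, of \<theta>] eta by (simp add: E_def field_simps)
  have C: "C > 0"
    using assms(1) unfolding C_def gegenbauer_one by (intro divide_pos_pos pochhammer_pos) auto
  \<comment> \<open>For \<open>l = 0\<close> both sides vanish, the left one by the convention built
    into \<open>C'\<close>.\<close>
  have ratio: "real d * (real d - 1) * C' = real l * (real l + real d - 1) * C"
    using gegenbauer_one_ratio[of l d] by (cases "l = 0") (auto simp: C_def C'_def)
  have K: "Kconst d l = real (Ndim d l) / (sphere_area d * C)" by (simp add: Kconst_def C_def)
  have area: "density (sph d \<theta>) * sphere_area d = real (Ndim d l)"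
    by (rule density_sphere_area)
  \<comment> \<open>Both sides keep the factor \<open>d\<close>, as \<open>E\<close> and
    \<open>ratio\<close> are stated with it; it is cancelled afterwards. If the area is 0,
    \<open>area\<close> forces \<open>Ndim d l = 0\<close>, and both sides vanish because division
    by 0 gives 0.\<close>
  have "real d * (E / (eta d j \<theta>)\<^sup>2) = real d * ((real d - 1) * Kconst d l * C')"
  proof (cases "sphere_area d = 0")
    case True
    then have "Ndim d l = 0" using area by simp
    then have "density (sph d \<theta>) = 0" unfolding density_def by simp
    then show ?thesis using E by (simp add: Kconst_def True)
  next
    case False
    then have "density (sph d \<theta>) = real (Ndim d l) / sphere_area d"
      using area by (simp add: field_simps)
    then have "real d * (E / (eta d j \<theta>)\<^sup>2) =
      (real l * (real l + real d - 1) * C) * (real (Ndim d l) / (sphere_area d * C))"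
      using E C by simp
    also have "\<dots> = real d * ((real d - 1) * Kconst d l * C')"
      unfolding ratio[symmetric] K by (simp only: mult_ac)
    finally show ?thesis .
  qed
  then have "E / (eta d j \<theta>)\<^sup>2 = (real d - 1) * Kconst d l * C'"
    using assms(1) by (simp only: mult_cancel_left) simp
  then show "(\<Sum>m=1..Ndim d l. (1 / (eta d j \<theta>)\<^sup>2) *
         (cmod (vector_derivative (\<lambda>t. Y m (sph d (\<theta>(j := t)))) (at (\<theta> j))))\<^sup>2)
     = (real d - 1) * Kconst d l * (if l = 0 then 0 else gegenbauer (l - 1) ((real d + 1) / 2) 1)"
    unfolding lhs C'_def .
qed

end
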